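(* Let $\xi$ be a complex random variable which is $C_\xi$-good for some $C_\xi \geq 1$. There exists a constant $C' \geq 1$, depending only on $C_\xi$, for which the following holds. For $\rho \in (0,1)$ let $$\boldsymbol{V}_\rho := \{\boldsymbol{v} \in (\mathbb{Z}+i\mathbb{Z})^n : \rho_{1,\xi}(\boldsymbol{v}) \geq \rho\}.$$ Let $n,s,k \in \mathbb{N}$ with $1000C_\xi \leq k \leq \sqrt{s} \leq s \leq n/\log n$. If $\rho \geq C'\max\{e^{-s/k}, s^{-k/4}\}$ and $p$ is an odd prime with $2^{n/s} \geq p \geq C'\rho^{-1}$, then $$|\varphi_p(\boldsymbol{V}_\rho)| \leq \left(\frac{5np^2}{s}\right)^s + \left(\frac{C'\rho^{-1}}{\sqrt{s/k}}\right)^n.$$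
   Context: A complex random variable $\xi$ is called $C$-good (for $C\geq 1$) if $\Pr(C^{-1} \leq |\xi_1 - \xi_2| \leq C) \geq C^{-1}$, where $\xi_1,\xi_2$ are independent copies of $\xi$. For $\boldsymbol{v} = (v_1,\dots,v_n)\in\mathbb{C}^n$ and $r\geq 0$, $\rho_{r,\xi}(\boldsymbol{v}) := \sup_{x \in \mathbb{C}}\Pr\left(v_1\xi_1 + \dots + v_n\xi_n \in B(x,r)\right)$, where $\xi_1,\dots,\xi_n$ are independent copies of $\xi$ and $B(x,r)$ is the disc of radius $r$ centered at $x$. The map $\varphi_p : (\mathbb{Z}+i\mathbb{Z})^n \to (\mathbb{F}_p + i\mathbb{F}_p)^n$ is the natural map reducing the real and imaginary parts of each coordinate modulo $p$. Logarithms are natural. *)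

theory Defs
  imports "HOL-Probability.Probability" "HOL-Computational_Algebra.Primes"
begin

text \<open>A complex random variable xi is represented by its distribution M, a probability
  measure on the Borel sets of the complex plane.  Independent copies of xi are
  modelled by product measures.\<close>

definition is_cplx_rv :: "complex measure \<Rightarrow> bool" where
  "is_cplx_rv M \<longleftrightarrow> prob_space M \<and> sets M = sets borel"

definition good :: "real \<Rightarrow> complex measure \<Rightarrow> bool" where
  "good C M \<longleftrightarrow> C \<ge> 1 \<and>
     measure (M \<Otimes>\<^sub>M M) {z. 1 / C \<le> cmod (fst z - snd z) \<and> cmod (fst z - snd z) \<le> C} \<ge> 1 / C"

text \<open>Gaussian integer vectors of length n: a + i b is represented by the pair (a,b);
  vectors are functions on nat that vanish (are (0,0)) outside {..<n}.\<close>
definition gvecs :: "nat \<Rightarrow> (nat \<Rightarrow> int \<times> int) set" where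
  "gvecs n = {v. \<forall>i\<ge>n. v i = (0, 0)}"

definition to_cplx :: "int \<times> int \<Rightarrow> complex" where
  "to_cplx z = Complex (of_int (fst z)) (of_int (snd z))"

definition rho_conc :: "real \<Rightarrow> complex measure \<Rightarrow> nat \<Rightarrow> (nat \<Rightarrow> int \<times> int) \<Rightarrow> real" where
  "rho_conc r M n v = (SUP x :: complex.
     measure (PiM {..<n} (\<lambda>_. M))
       {w \<in> space (PiM {..<n} (\<lambda>_. M)). (\<Sum>i<n. to_cplx (v i) * w i) \<in> cball x r})"

definition Vrho :: "complex measure \<Rightarrow> nat \<Rightarrow> real \<Rightarrow> (nat \<Rightarrow> int \<times> int) set" where
  "Vrho M n \<rho> = {v \<in> gvecs n. rho_conc 1 M n v \<ge> \<rho>}"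

definition phi :: "nat \<Rightarrow> (nat \<Rightarrow> int \<times> int) \<Rightarrow> (nat \<Rightarrow> int \<times> int)" where
  "phi p v = (\<lambda>i. (fst (v i) mod int p, snd (v i) mod int p))"

end

theory Submission
  imports Defs
begin

text \<open>
  Write \<open>a\<close> for the reduction of \<open>v\<close> modulo \<open>p\<close>. Majorising the indicator of the disc by a Gaussian, whose
  Fourier transform is again Gaussian, and averaging over the good annulus for \<open>\<xi>\<^sub>1 - \<xi>\<^sub>2\<close> bounds the
  small ball probability by a point probability of the lazy walk \<open>\<Sum>\<eta>\<^sub>j v\<^sub>j\<close> on the Gaussian integers, hence
  by the average over \<open>w\<close> in \<open>(\<int>/p)\<^sup>2\<close> of \<open>exp (- \<mu> g(w))\<close>, where \<open>g(w)\<close> is the sum of \<open>1 - cos (2\<pi> a\<^sub>j\<cdot>w / p)\<close>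
  over any set \<open>S\<close> of coordinates. Halasz's argument bounds this average by the number of solutions of
  \<open>a (r 1) + \<dots> + a (r k) = a (r (k + 1)) + \<dots> + a (r (2 k))\<close> with indices in \<open>S\<close>. So if
  \<open>v\<close> has large concentration, then every set of at least \<open>s\<close> coordinates of the support of \<open>a\<close> carries many such relations, and in most of them at least \<open>k/2\<close>
  indices occur exactly once. Such a relation determines one entry of \<open>a\<close> from the others; double counting
  triples (vector, relation, index occurring once) and removing one coordinate at a time bounds the
  number of such \<open>a\<close>. Vectors with at most \<open>s\<close> nonzero entries are counted trivially.
\<close>

section \<open>Characters of the plane modulo p\<close>

text \<open>Only the entries of \<open>v\<close> are integral, while \<open>\<xi>\<close> is
  arbitrary, so the random sum itself cannot be reduced modulo \<open>p\<close>. Convexity replaces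
  each factor attached to a fixed difference \<open>y\<close> of two copies by the characteristic
  function of a lazy sign. Then \<open>y\<close> survives only as a scale of the lattice point
  reached, and a Gaussian has a bounded sum over the lattice.

  Each bound on \<open>\<rho>\<close> and \<open>p\<close> pays for one loss.
  \<open>C' / \<rho> \<le> p\<close> covers the additive \<open>p\<close> in the count of residues
  of small energy; \<open>exp (- s / k)\<close> covers residues of energy above half of
  \<open>card S\<close>; \<open>s powr (- k / 4)\<close> covers relations with too few distinct
  indices; \<open>p \<le> 2 powr (n / s)\<close> turns the trivial count for the last
  \<open>s\<close> coordinates into a factor 4 per coordinate. The gain \<open>sqrt (s / k)\<close>
  comes from comparing sublevel sets of the energy with the one at height
  \<open>card S / (4 * k)\<close>.

  Removing coordinates must preserve the hypothesis. This is why relations are demanded on every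
  large index set, and it is available because the factors of the Fourier product outside
  \<open>S\<close> are at most 1.\<close>

definition dotp :: "int \<times> int \<Rightarrow> int \<times> int \<Rightarrow> int" where
  "dotp v w = fst v * fst w + snd v * snd w"

definition grid :: "nat \<Rightarrow> (int \<times> int) set" where
  "grid p = {0..<int p} \<times> {0..<int p}"

definition chr :: "nat \<Rightarrow> int \<Rightarrow> complex" where
  "chr p t = cis (2 * pi * of_int t / of_nat p)"

definition pdvd :: "nat \<Rightarrow> int \<times> int \<Rightarrow> bool" where
  "pdvd p v \<longleftrightarrow> int p dvd fst v \<and> int p dvd snd v"

lemma finite_grid [simp]: "finite (grid p)"
  by (simp add: grid_def)

lemma card_grid: "card (grid p) = p ^ 2"
  by (simp add: grid_def card_cartesian_product power2_eq_square)

lemma chr_add: "chr p (s + t) = chr p s * chr p t"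
  by (simp add: chr_def cis_mult add_divide_distrib distrib_left)

lemma chr_0 [simp]: "chr p 0 = 1"
  by (simp add: chr_def)

lemma chr_minus: "chr p (- t) = cnj (chr p t)"
  by (simp add: chr_def cis_cnj)

lemma norm_chr [simp]: "cmod (chr p t) = 1"
  by (simp add: chr_def)

lemma Re_chr: "Re (chr p t) = cos (2 * pi * of_int t / of_nat p)"
  by (simp add: chr_def)

lemma chr_sum: "chr p (\<Sum>i\<in>I. f i) = (\<Prod>i\<in>I. chr p (f i))"
  by (induction I rule: infinite_finite_induct) (auto simp: chr_add)

lemma chr_eq_1_iff:
  assumes "p > 0"
  shows "chr p t = 1 \<longleftrightarrow> int p dvd t"
proof -
  have "chr p t = 1 \<longleftrightarrow> (\<exists>n::int. 2 * pi * of_int t / of_nat p = of_int n * (2 * pi))"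
    unfolding chr_def cis_conv_exp exp_eq_1 by (auto simp: mult_ac)
  also have "\<dots> \<longleftrightarrow> (\<exists>n::int. t = int p * n)"
  proof (intro iff_exI)
    fix n :: int
    have "2 * pi * of_int t / of_nat p = of_int n * (2 * pi) \<longleftrightarrow> real_of_int t = of_int (int p * n)"
      using assms by (auto simp: field_simps)
    also have "\<dots> \<longleftrightarrow> t = int p * n" by linarith
    finally show "2 * pi * of_int t / of_nat p = of_int n * (2 * pi) \<longleftrightarrow> t = int p * n" .
  qed
  finally show ?thesis by (auto simp: dvd_def)
qed

lemma chr_cong:
  assumes "p > 0" "s mod int p = t mod int p"
  shows "chr p s = chr p t"
proof -
  have "int p dvd s - t" using assms(2) by (simp add: mod_eq_dvd_iff)
  then have "chr p (s - t) = 1" using chr_eq_1_iff assms by blast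
  then show ?thesis using chr_add[of p "s - t" t] by simp
qed

lemma sum_chr_1:
  assumes "p > 0"
  shows "(\<Sum>x\<in>{0..<int p}. chr p (b * x)) = (if int p dvd b then of_nat p else 0)"
proof -
  have pow: "chr p (b * int x) = chr p b ^ x" for x
    by (induction x) (auto simp: distrib_left chr_add mult_ac)
  have "(\<Sum>x\<in>{0..<int p}. chr p (b * x)) = (\<Sum>x<p. chr p (b * int x))"
    by (rule sum.reindex_bij_witness[of _ int nat]) auto
  also have "\<dots> = (\<Sum>x<p. chr p b ^ x)" by (simp add: pow)
  also have "\<dots> = (if int p dvd b then of_nat p else 0)"
  proof (cases "int p dvd b")
    case True
    then show ?thesis using chr_eq_1_iff[OF assms, of b] by simp
  next
    case False
    then have ne: "chr p b \<noteq> 1" using chr_eq_1_iff[OF assms] by simp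
    have "chr p b ^ p = 1" using pow[of p] chr_eq_1_iff[OF assms, of "b * int p"] by simp
    then show ?thesis using False ne by (simp add: sum_gp_strict)
  qed
  finally show ?thesis .
qed

lemma sum_chr_grid:
  assumes "p > 0"
  shows "(\<Sum>w\<in>grid p. chr p (dotp v w)) = (if pdvd p v then of_nat p ^ 2 else 0)"
proof -
  have "(\<Sum>w\<in>grid p. chr p (dotp v w)) =
      (\<Sum>x\<in>{0..<int p}. \<Sum>y\<in>{0..<int p}. chr p (fst v * x) * chr p (snd v * y))"
    unfolding grid_def by (simp add: sum.cartesian_product dotp_def chr_add case_prod_beta)
  also have "\<dots> = (\<Sum>x\<in>{0..<int p}. chr p (fst v * x)) * (\<Sum>y\<in>{0..<int p}. chr p (snd v * y))"
    by (simp add: sum_product)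
  finally show ?thesis using sum_chr_1[OF assms] by (auto simp: pdvd_def power2_eq_square)
qed

text \<open>Defined at every integer point, not only on the grid, so that points can be added and
  negated freely; \<open>energy_red\<close> returns to representatives.\<close>

definition energy :: "nat \<Rightarrow> (nat \<Rightarrow> int \<times> int) \<Rightarrow> nat set \<Rightarrow> int \<times> int \<Rightarrow> real" where
  "energy p a S w = (\<Sum>j\<in>S. 1 - Re (chr p (dotp (a j) w)))"

section \<open>Halasz's inequality\<close>

lemma energy_nonneg: "energy p a S w \<ge> 0"
  unfolding energy_def
  by (intro sum_nonneg) (metis complex_Re_le_cmod diff_ge_0_iff_ge norm_chr)

definition red :: "nat \<Rightarrow> int \<times> int \<Rightarrow> int \<times> int" where
  "red p w = (fst w mod int p, snd w mod int p)"

lemma red_in_grid: "p > 0 \<Longrightarrow> red p w \<in> grid p"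
  by (simp add: red_def grid_def)

lemma red_id: "w \<in> grid p \<Longrightarrow> red p w = w"
  by (auto simp: red_def grid_def)

lemma chr_red_right: "p > 0 \<Longrightarrow> chr p (dotp v (red p w)) = chr p (dotp v w)"
  by (rule chr_cong) (auto simp: red_def dotp_def mod_mult_right_eq intro!: mod_add_cong)

lemma chr_red_left: "p > 0 \<Longrightarrow> chr p (dotp (red p v) w) = chr p (dotp v w)"
  by (rule chr_cong) (auto simp: red_def dotp_def mod_mult_left_eq intro!: mod_add_cong)

lemma energy_red: "p > 0 \<Longrightarrow> energy p a S (red p w) = energy p a S w"
  by (simp add: energy_def chr_red_right)

lemma energy_uminus: "energy p a S (- w) = energy p a S w"
proof -
  have "dotp v (- w) = - dotp v w" for v by (simp add: dotp_def)
  then show ?thesis by (simp add: energy_def chr_minus)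
qed

lemma energy_0: "energy p a S 0 = 0"
  by (simp add: energy_def dotp_def)

text \<open>The square root of the energy is an \<open>\<ell>\<^sup>2\<close> norm, because \<open>1 - cos x = 2 sin\<^sup>2 (x/2)\<close> and \<open>\<bar>sin\<bar>\<close> is subadditive.\<close>

lemma sqrt_energy_L2:
  "sqrt (energy p a S w) = L2_set (\<lambda>j. sqrt 2 * \<bar>sin (pi * of_int (dotp (a j) w) / of_nat p)\<bar>) S"
proof -
  have "1 - Re (chr p t) = (sqrt 2 * \<bar>sin (pi * of_int t / of_nat p)\<bar>)\<^sup>2" for t
    using cos_double_sin[of "pi * of_int t / of_nat p"]
    by (simp add: Re_chr power_mult_distrib mult.assoc)
  then show ?thesis by (simp add: energy_def L2_set_def)
qed

lemma abs_sin_add: "\<bar>sin (x + y)\<bar> \<le> \<bar>sin x\<bar> + \<bar>sin (y::real)\<bar>"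
proof -
  have "\<bar>sin (x + y)\<bar> \<le> \<bar>sin x\<bar> * \<bar>cos y\<bar> + \<bar>cos x\<bar> * \<bar>sin y\<bar>"
    by (simp add: sin_add abs_mult[symmetric])
  also have "\<dots> \<le> \<bar>sin x\<bar> * 1 + 1 * \<bar>sin y\<bar>"
    by (intro add_mono mult_mono) auto
  finally show ?thesis by simp
qed

lemma sqrt_energy_add:
  "sqrt (energy p a S (w + w')) \<le> sqrt (energy p a S w) + sqrt (energy p a S w')"
proof -
  let ?f = "\<lambda>w j. sqrt 2 * \<bar>sin (pi * of_int (dotp (a j) w) / of_nat p)\<bar>"
  have "L2_set (?f (w + w')) S \<le> L2_set (\<lambda>j. ?f w j + ?f w' j) S"
  proof (rule L2_set_mono)
    fix j
    have "pi * of_int (dotp (a j) (w + w')) / of_nat p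
       = pi * of_int (dotp (a j) w) / of_nat p + pi * of_int (dotp (a j) w') / of_nat p"
      by (simp add: dotp_def algebra_simps add_divide_distrib)
    then show "?f (w + w') j \<le> ?f w j + ?f w' j"
      using abs_sin_add by (simp flip: distrib_left)
  qed auto
  also have "\<dots> \<le> L2_set (?f w) S + L2_set (?f w') S"
    by (rule L2_set_triangle_ineq)
  finally show ?thesis by (simp add: sqrt_energy_L2)
qed

text \<open>If all determinants against a fixed nonzero \<open>t\<close> vanish modulo
  \<open>p\<close>, then \<open>T\<close> lies on the line through 0 and \<open>t\<close>. A
  coordinate in which \<open>t\<close> is nonzero is injective on that line, so \<open>T\<close> has
  at most \<open>p\<close> points.\<close>

lemma exists_independent:
  assumes p: "prime p" and T: "T \<subseteq> grid p" and card: "card T > p"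
  obtains t u where "t \<in> T" "u \<in> T" "\<not> int p dvd fst t * snd u - snd t * fst u"
proof -
  have p0: "p > 0" using p prime_gt_0_nat by blast
  have pz: "prime (int p)" using p by simp
  have "\<exists>t\<in>T. \<exists>u\<in>T. \<not> int p dvd fst t * snd u - snd t * fst u"
  proof (rule ccontr)
    assume "\<not> ?thesis"
    then have all: "int p dvd fst t * snd u - snd t * fst u" if "t \<in> T" "u \<in> T" for t u
      using that by blast
    have "finite T" using T finite_subset finite_grid by blast
    have "\<not> T \<subseteq> {(0,0)}"
    proof
      assume "T \<subseteq> {(0,0)}"
      then have "card T \<le> card {(0::int,0::int)}" by (intro card_mono) auto
      then show False using card p0 by simp
    qed
    then obtain t where t: "t \<in> T" "t \<noteq> (0,0)" by auto
    have cancel: "y = y'" if "\<not> int p dvd x" "int p dvd x * y - x * y'"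
       "y \<in> {0..<int p}" "y' \<in> {0..<int p}" for x y y' :: int
    proof -
      have "int p dvd x * (y - y')" using that(2) by (simp add: right_diff_distrib)
      then have "int p dvd y - y'" using that(1) pz prime_dvd_mult_iff by blast
      then have "y mod int p = y' mod int p" by (simp add: mod_eq_dvd_iff)
      then show ?thesis using that by simp
    qed
    have rng: "fst u \<in> {0..<int p}" "snd u \<in> {0..<int p}" if "u \<in> T" for u
      using that T by (auto simp: grid_def)
    have tr: "fst t \<in> {0..<int p}" "snd t \<in> {0..<int p}" using t T by (auto simp: grid_def)
    have nd: "\<not> int p dvd x" if "x \<in> {0..<int p}" "x \<noteq> 0" for x
      using that zdvd_not_zless[of x "int p"] by auto
    have "\<exists>f. inj_on f T \<and> f ` T \<subseteq> {0..<int p}"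
    proof (cases "fst t = 0")
      case False
      have "inj_on fst T"
      proof (rule inj_onI)
        fix u u' assume u: "u \<in> T" "u' \<in> T" "fst u = fst u'"
        have "int p dvd (fst t * snd u - snd t * fst u) - (fst t * snd u' - snd t * fst u')"
          by (rule dvd_diff[OF all[OF t(1) u(1)] all[OF t(1) u(2)]])
        then have "int p dvd fst t * snd u - fst t * snd u'" using u by simp
        then have "snd u = snd u'"
          by (rule cancel[OF nd[OF tr(1) False] _ rng(2)[OF u(1)] rng(2)[OF u(2)]])
        then show "u = u'" using u by (simp add: prod_eq_iff)
      qed
      moreover have "fst ` T \<subseteq> {0..<int p}" using T by (auto simp: grid_def)
      ultimately show ?thesis by blast
    next
      case True
      then have ne: "snd t \<noteq> 0" using t by (simp add: prod_eq_iff)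
      have "inj_on snd T"
      proof (rule inj_onI)
        fix u u' assume u: "u \<in> T" "u' \<in> T" "snd u = snd u'"
        have "int p dvd (fst t * snd u' - snd t * fst u') - (fst t * snd u - snd t * fst u)"
          by (rule dvd_diff[OF all[OF t(1) u(2)] all[OF t(1) u(1)]])
        then have "int p dvd snd t * fst u - snd t * fst u'" using u by simp
        then have "fst u = fst u'"
          by (rule cancel[OF nd[OF tr(2) ne] _ rng(1)[OF u(1)] rng(1)[OF u(2)]])
        then show "u = u'" using u by (simp add: prod_eq_iff)
      qed
      moreover have "snd ` T \<subseteq> {0..<int p}" using T by (auto simp: grid_def)
      ultimately show ?thesis by blast
    qed
    then obtain f where "inj_on f T" "f ` T \<subseteq> {0..<int p}" by blast
    then have "card T \<le> card {0..<int p}" by (intro card_inj_on_le) auto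
    then show False using card by simp
  qed
  then show thesis using that by blast
qed

text \<open>A set of more than \<open>p\<close> residues contains two independent vectors, and by Cramer's rule these generate everything.\<close>

lemma closed_under_large_set:
  assumes p: "prime p" and T: "T \<subseteq> grid p" and card: "card T > p"
    and P0: "P 0" and step: "\<And>w t. P w \<Longrightarrow> t \<in> T \<Longrightarrow> P (w + t)"
    and red: "\<And>w. P w \<Longrightarrow> P (red p w)" and w: "w \<in> grid p"
  shows "P w"
proof -
  have p0: "p > 0" using p prime_gt_0_nat by blast
  obtain t u where tu: "t \<in> T" "u \<in> T" and nd: "\<not> int p dvd fst t * snd u - snd t * fst u"
    using exists_independent[OF p T card] .
  define d where "d = fst t * snd u - snd t * fst u"
  have "coprime d (int p)"
    using nd p unfolding d_def by (metis coprime_commute prime_imp_coprime prime_nat_int_transfer)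
  then have "gcd d (int p) = 1" by simp
  then obtain d' e where de: "d' * d + e * int p = 1"
    using bezout_int[of d "int p"] by metis
  define comb where "comb m n = (int m * fst t + int n * fst u, int m * snd t + int n * snd u)" for m n
  have 1: "P (comb m 0)" for m
  proof (induction m)
    case 0
    then show ?case using P0 by (simp add: comb_def zero_prod_def)
  next
    case (Suc m)
    have "comb (Suc m) 0 = comb m 0 + t" by (simp add: comb_def prod_eq_iff algebra_simps)
    then show ?case using Suc step tu by simp
  qed
  have 2: "P (comb m n)" for m n
  proof (induction n)
    case 0
    then show ?case using 1 .
  next
    case (Suc n)
    have "comb m (Suc n) = comb m n + u" by (simp add: comb_def prod_eq_iff algebra_simps)
    then show ?case using Suc step tu by simp
  qed
  define A where "A = d' * (fst w * snd u - snd w * fst u)"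
  define B where "B = d' * (fst t * snd w - snd t * fst w)"
  \<comment> \<open>\<open>A\<close> and \<open>B\<close> are the Cramer coefficients, with
    \<open>d'\<close> in the role of the inverse of \<open>d\<close>. Nonnegative representatives
    are needed because \<open>P\<close> is closed under adding elements of \<open>T\<close>, not
    under subtracting them.\<close>
  define m where "m = nat (A mod int p)"
  define n where "n = nat (B mod int p)"
  have m: "int m = A - int p * (A div int p)" and n: "int n = B - int p * (B div int p)"
    using p0 by (simp_all add: m_def n_def minus_mult_div_eq_mod)
  have "int m * fst t + int n * fst u - fst w = (A * fst t + B * fst u) - fst w
      - int p * (A div int p * fst t + B div int p * fst u)"
    by (simp add: m n algebra_simps)
  also have "A * fst t + B * fst u = (d' * d) * fst w"
    by (simp add: A_def B_def d_def algebra_simps)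
  also have "d' * d = 1 - e * int p" using de by simp
  also have "(1 - e * int p) * fst w - fst w - int p * (A div int p * fst t + B div int p * fst u)
      = int p * (- e * fst w - (A div int p * fst t + B div int p * fst u))"
    by (simp add: algebra_simps)
  finally have c1: "int p dvd int m * fst t + int n * fst u - fst w"
    by simp
  have "int m * snd t + int n * snd u - snd w = (A * snd t + B * snd u) - snd w
      - int p * (A div int p * snd t + B div int p * snd u)"
    by (simp add: m n algebra_simps)
  also have "A * snd t + B * snd u = (d' * d) * snd w"
    by (simp add: A_def B_def d_def algebra_simps)
  also have "d' * d = 1 - e * int p" using de by simp
  also have "(1 - e * int p) * snd w - snd w - int p * (A div int p * snd t + B div int p * snd u)
      = int p * (- e * snd w - (A div int p * snd t + B div int p * snd u))"
    by (simp add: algebra_simps)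
  finally have c2: "int p dvd int m * snd t + int n * snd u - snd w"
    by simp
  have "red p (comb m n) = red p w"
    using c1 c2 by (simp add: red_def comb_def mod_eq_dvd_iff)
  also have "\<dots> = w" using w by (rule red_id)
  finally show ?thesis using red[OF 2[of m n]] by simp
qed

section \<open>Mean energy and growth of the sublevel sets\<close>

lemma sum_energy:
  assumes "p > 0" "finite S" "\<And>j. j \<in> S \<Longrightarrow> \<not> pdvd p (a j)"
  shows "(\<Sum>w\<in>grid p. energy p a S w) = card S * p\<^sup>2"
proof -
  have "(\<Sum>w\<in>grid p. energy p a S w) = (\<Sum>j\<in>S. \<Sum>w\<in>grid p. 1 - Re (chr p (dotp (a j) w)))"
    unfolding energy_def by (rule sum.swap)
  also have "\<dots> = (\<Sum>j\<in>S. real p ^ 2)"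
  proof (rule sum.cong)
    fix j assume "j \<in> S"
    then have "(\<Sum>w\<in>grid p. chr p (dotp (a j) w)) = 0"
      using sum_chr_grid[OF assms(1)] assms(3) by simp
    then have "(\<Sum>w\<in>grid p. Re (chr p (dotp (a j) w))) = 0"
      by (metis Re_sum zero_complex.sel(1))
    then show "(\<Sum>w\<in>grid p. 1 - Re (chr p (dotp (a j) w))) = real p ^ 2"
      by (simp add: sum_subtractf card_grid)
  qed simp
  finally show ?thesis by simp
qed

text \<open>The mean of the energy over the grid is exactly \<open>card S\<close>, because every
  nontrivial character has mean 0. The point found here is the distant target that a walk from 0
  with small steps has to reach.\<close>

lemma exists_large_energy:
  assumes "p > 0" "finite S" "\<And>j. j \<in> S \<Longrightarrow> \<not> pdvd p (a j)"
  obtains w where "w \<in> grid p" "energy p a S w \<ge> card S"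
proof -
  have "\<exists>w\<in>grid p. energy p a S w \<ge> card S"
  proof (rule ccontr)
    assume "\<not> ?thesis"
    then have "(\<Sum>w\<in>grid p. energy p a S w) < (\<Sum>w\<in>grid p. real (card S))"
      using red_in_grid[OF assms(1)] by (intro sum_strict_mono) (auto simp: not_le)
    then show False using sum_energy[OF assms] by (simp add: card_grid)
  qed
  then show thesis using that by blast
qed

lemma inj_on_red_add: "inj_on (\<lambda>t. red p (c + t)) (grid p)"
proof (rule inj_onI)
  fix t u assume tu: "t \<in> grid p" "u \<in> grid p" and eq: "red p (c + t) = red p (c + u)"
  have "red p t = red p u"
    using eq by (simp add: red_def mod_eq_dvd_iff)
  then show "t = u" using tu red_id by metis
qed

text \<open>Halasz's growth estimate for the sublevel sets. If \<open>T\<^sub>r\<close> has more than \<open>p\<close> elements, then walking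
  along it from 0 reaches every residue, so the square root of the energy (which changes by at most
  \<open>\<surd>r\<close> per step) visits every interval of length \<open>\<surd>r\<close> below \<open>\<surd>F\<close>; translates of \<open>T\<^sub>r\<close> centred at points
  in intervals spaced \<open>3 \<surd>r\<close> apart are disjoint subsets of \<open>T\<^sub>F\<close>.\<close>

lemma card_sublevel:
  fixes r F :: real
  assumes p: "prime p" and S: "finite S" "\<And>j. j \<in> S \<Longrightarrow> \<not> pdvd p (a j)"
    and r: "0 < r" "r \<le> F" and F: "F \<le> card S"
  defines "T \<equiv> \<lambda>r. {w \<in> grid p. energy p a S w \<le> r}"
  shows "real (card (T r)) \<le> p + 4 * sqrt (r / F) * card (T F)"
proof (cases "card (T r) \<le> p")
  case True
  then have "real (card (T r)) \<le> real p" by simp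
  moreover have "0 \<le> 4 * sqrt (r / F) * card (T F)" using r by simp
  ultimately show ?thesis by linarith
next
  case False
  have p0: "p > 0" using p prime_gt_0_nat by blast
  define E where "E = (\<lambda>w. sqrt (energy p a S w))"
  have E_add: "E (w + w') \<le> E w + E w'" for w w' unfolding E_def by (rule sqrt_energy_add)
  have E_red: "E (red p w) = E w" for w unfolding E_def using energy_red p0 by simp
  have E_um: "E (- w) = E w" for w unfolding E_def using energy_uminus by simp
  have E_0: "E 0 = 0" unfolding E_def using energy_0 by simp
  have fin: "finite (T r)" for r unfolding T_def by simp
  have T_E: "E t \<le> sqrt r" if "t \<in> T r" for t r using that unfolding T_def E_def by simp
  have sub: "T r \<subseteq> grid p" for r unfolding T_def by blast
  obtain w1 where w1: "w1 \<in> grid p" "energy p a S w1 \<ge> card S"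
    using exists_large_energy[OF p0 S(1), of a] S(2) by blast
  have Ew1: "E w1 \<ge> sqrt F" unfolding E_def using w1 F by simp
  have sr: "sqrt r > 0" using r by simp
  \<comment> \<open>A discrete intermediate value argument: if the window were empty, the points
    with \<open>E\<close> at most its lower end would be closed under steps from \<open>T r\<close>,
    hence would be the whole grid, including \<open>w1\<close>.\<close>
  have ex: "\<exists>c. c \<in> grid p \<and> (3 * real i - 1) * sqrt r < E c \<and> E c \<le> 3 * real i * sqrt r"
    if i: "3 * real i * sqrt r + sqrt r \<le> sqrt F" for i :: nat
  proof (cases "i = 0")
    case True
    have "0 \<in> grid p" using p0 by (simp add: grid_def zero_prod_def)
    then show ?thesis using True E_0 sr by (intro exI[of _ 0]) simp
  next
    case i0: False
    show ?thesis
    proof (rule ccontr)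
      assume no: "\<not> ?thesis"
      have "E w1 \<le> (3 * real i - 1) * sqrt r"
      proof (rule closed_under_large_set[where P = "\<lambda>w. E w \<le> (3 * real i - 1) * sqrt r",
            OF p sub _ _ _ _ w1(1)])
        show "p < card (T r)" using False by simp
        have "1 \<le> real i" using i0 by simp
        then show "E 0 \<le> (3 * real i - 1) * sqrt r" using E_0 sr by simp
        show "E (red p w) \<le> (3 * real i - 1) * sqrt r" if "E w \<le> (3 * real i - 1) * sqrt r" for w
          using that E_red by simp
        show "E (w + t) \<le> (3 * real i - 1) * sqrt r"
          if "E w \<le> (3 * real i - 1) * sqrt r" "t \<in> T r" for w t
        proof -
          have "E (w + t) \<le> (3 * real i - 1) * sqrt r + sqrt r"
            using E_add[of w t] that T_E[of t r] by linarith
          then have "E (red p (w + t)) \<le> 3 * real i * sqrt r"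
            using E_red by (simp add: algebra_simps)
          then show ?thesis using no red_in_grid[OF p0, of "w + t"] E_red[of "w + t"] by fastforce
        qed
      qed
      moreover have "(3 * real i - 1) * sqrt r < sqrt F"
        using i sr unfolding left_diff_distrib by linarith
      ultimately show False using Ew1 by simp
    qed
  qed
  define x where "x = sqrt (F / r)"
  have x1: "x \<ge> 1" unfolding x_def using r by simp
  have xr: "x * sqrt r = sqrt F" unfolding x_def using r by (simp add: real_sqrt_divide)
  \<comment> \<open>The number of indices \<open>i\<close> for which the ball of radius
    \<open>sqrt r\<close> around the window at \<open>3 * i * sqrt r\<close> stays below
    \<open>sqrt F\<close>, that is, \<open>3 * i + 1 \<le> x\<close>.\<close>
  define N where "N = nat \<lfloor>(x - 1) / 3\<rfloor> + 1"
  have Ni: "3 * real i * sqrt r + sqrt r \<le> sqrt F" if "i < N" for i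
  proof -
    have fl: "0 \<le> \<lfloor>(x - 1) / 3\<rfloor>" using x1 by simp
    have "int i \<le> \<lfloor>(x - 1) / 3\<rfloor>"
      using that fl unfolding N_def by linarith
    then have "real i \<le> (x - 1) / 3" by linarith
    then have "3 * real i + 1 \<le> x" by simp
    then have "(3 * real i + 1) * sqrt r \<le> x * sqrt r" using sr by (intro mult_right_mono) auto
    then show ?thesis using xr by (simp add: algebra_simps)
  qed
  have "\<forall>i<N. \<exists>c. c \<in> grid p \<and> (3 * real i - 1) * sqrt r < E c \<and> E c \<le> 3 * real i * sqrt r"
    using ex Ni by blast
  then obtain c where c: "\<And>i. i < N \<Longrightarrow> c i \<in> grid p"
    "\<And>i. i < N \<Longrightarrow> (3 * real i - 1) * sqrt r < E (c i)" "\<And>i. i < N \<Longrightarrow> E (c i) \<le> 3 * real i * sqrt r"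
    by metis
  define D where "D i = (\<lambda>t. red p (c i + t)) ` T r" for i
  have cardD: "card (D i) = card (T r)" for i
    unfolding D_def by (rule card_image) (rule inj_on_subset[OF inj_on_red_add sub])
  have D_sub: "D i \<subseteq> T F" if "i < N" for i
  proof
    fix w assume "w \<in> D i"
    then obtain t where t: "t \<in> T r" "w = red p (c i + t)" unfolding D_def by blast
    have "E w \<le> E (c i) + E t" using t E_red E_add by simp
    then have "E w \<le> sqrt F" using T_E[OF t(1)] c(3)[OF that] Ni[OF that] by linarith
    then show "w \<in> T F" using t red_in_grid[OF p0] unfolding T_def E_def by simp
  qed
  \<comment> \<open>Spacing 3 is window length 1 plus two radii; the strict lower end of the window
    excludes the boundary case.\<close>
  have disj: "D i \<inter> D j = {}" if ij: "i < j" "j < N" for i j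
  proof (rule ccontr)
    assume "D i \<inter> D j \<noteq> {}"
    then obtain t u where tu: "t \<in> T r" "u \<in> T r" "red p (c i + t) = red p (c j + u)"
      unfolding D_def by blast
    have "E (c j) \<le> E (c j + u) + E (- u)" using E_add[of "c j + u" "- u"] by simp
    also have "E (c j + u) = E (c i + t)" using tu(3) E_red by metis
    also have "E (c i + t) + E (- u) \<le> E (c i) + E t + E u" using E_add[of "c i" t] E_um by simp
    also have "\<dots> \<le> 3 * real i * sqrt r + sqrt r + sqrt r"
      using T_E tu c(3)[of i] ij by (intro add_mono) auto
    also have "\<dots> = (3 * (real i + 1) - 1) * sqrt r" by (simp add: algebra_simps)
    also have "\<dots> \<le> (3 * real j - 1) * sqrt r" using ij sr by (intro mult_right_mono) auto
    also have "\<dots> < E (c j)" using c(2) ij by simp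
    finally show False by simp
  qed
  have "card (\<Union>i<N. D i) = (\<Sum>i<N. card (D i))"
  proof (rule card_UN_disjoint)
    show "\<forall>i\<in>{..<N}. \<forall>j\<in>{..<N}. i \<noteq> j \<longrightarrow> D i \<inter> D j = {}"
      using disj by (metis Int_commute lessThan_iff linorder_neqE_nat)
  qed (auto simp: D_def fin)
  also have "\<dots> = N * card (T r)" by (simp add: cardD)
  finally have "N * card (T r) = card (\<Union>i<N. D i)" by simp
  also have "\<dots> \<le> card (T F)" using D_sub fin by (intro card_mono) auto
  finally have N_le: "real N * card (T r) \<le> card (T F)" by (metis of_nat_le_iff of_nat_mult)
  \<comment> \<open>\<open>N \<ge> 1\<close> settles \<open>x \<le> 4\<close>, and
    \<open>(x - 1) / 3 \<ge> x / 4\<close> holds from \<open>x = 4\<close> on. This is the factor 4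
    of the statement.\<close>
  have "x / 4 \<le> real N"
  proof (cases "x \<le> 4")
    case True
    then show ?thesis unfolding N_def by simp
  next
    case False
    have "(x - 1) / 3 \<le> real N" unfolding N_def using x1 by linarith
    then have "x - 1 \<le> 3 * real N" by simp
    then show ?thesis using False by simp
  qed
  then have "x / 4 * card (T r) \<le> real N * card (T r)" by (intro mult_right_mono) auto
  then have "x * card (T r) \<le> 4 * card (T F)" using N_le by linarith
  then have "sqrt (r / F) * (x * card (T r)) \<le> sqrt (r / F) * (4 * card (T F))"
    using r by (intro mult_left_mono) auto
  moreover have "sqrt (r / F) * x = 1" unfolding x_def using r by (simp flip: real_sqrt_mult)
  then have "sqrt (r / F) * (x * card (T r)) = card (T r)" by (simp flip: mult.assoc)
  ultimately have "card (T r) \<le> 4 * sqrt (r / F) * card (T F)" by linarith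
  then show ?thesis by simp
qed

text \<open>Slice by the integer part \<open>R\<close> of \<open>g\<close>. A slice has at most
  \<open>P + Q * sqrt (R + 1)\<close>, so at most \<open>(P + Q) * (R + 1)\<close>, points, each of
  weight at most \<open>exp (- \<mu>) ^ R\<close>; the differentiated geometric series sums
  this.\<close>

lemma sum_exp_layers:
  fixes g :: "'a \<Rightarrow> real"
  assumes B: "finite B" "\<And>w. w \<in> B \<Longrightarrow> 0 \<le> g w" and F: "F > 0" and \<mu>: "\<mu> > 0" and PQ: "P \<ge> 0" "Q \<ge> 0"
    and card: "\<And>r. 0 < r \<Longrightarrow> r \<le> F \<Longrightarrow> real (card {w \<in> B. g w \<le> r}) \<le> P + Q * sqrt r"
  shows "(\<Sum>w | w \<in> B \<and> g w \<le> F. exp (- \<mu> * g w)) \<le> (P + Q) / (1 - exp (- \<mu>))\<^sup>2"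
proof -
  define x where "x = exp (- \<mu>)"
  have x: "0 < x" "x < 1" using \<mu> by (auto simp: x_def)
  define N where "N = nat \<lfloor>F\<rfloor>"
  define BF where "BF = {w \<in> B. g w \<le> F}"
  have inner: "(\<Sum>w | w \<in> BF \<and> nat \<lfloor>g w\<rfloor> = R. exp (- \<mu> * g w)) \<le> (P + Q) * (real (Suc R) * x ^ R)" for R
  proof -
    have "(\<Sum>w | w \<in> BF \<and> nat \<lfloor>g w\<rfloor> = R. exp (- \<mu> * g w)) \<le> (\<Sum>w | w \<in> BF \<and> nat \<lfloor>g w\<rfloor> = R. x ^ R)"
    proof (rule sum_mono)
      fix w assume w: "w \<in> {w. w \<in> BF \<and> nat \<lfloor>g w\<rfloor> = R}"
      have "real R \<le> g w" using w B(2)[of w] by (auto simp: BF_def)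
      then have "exp (- \<mu> * g w) \<le> exp (real R * - \<mu>)" using \<mu> by simp
      then show "exp (- \<mu> * g w) \<le> x ^ R" unfolding x_def exp_of_nat_mult .
    qed
    also have "\<dots> = card {w \<in> BF. nat \<lfloor>g w\<rfloor> = R} * x ^ R" by simp
    also have "\<dots> \<le> ((P + Q) * real (Suc R)) * x ^ R"
    proof (rule mult_right_mono)
      \<comment> \<open>The minimum with \<open>F\<close> matters in the last slice: the counting
        hypothesis stops at \<open>F\<close>.\<close>
      define r where "r = min (real (Suc R)) F"
      have r: "0 < r" "r \<le> F" using F by (auto simp: r_def)
      have "{w \<in> BF. nat \<lfloor>g w\<rfloor> = R} \<subseteq> {w \<in> B. g w \<le> r}"
      proof
        fix w assume "w \<in> {w \<in> BF. nat \<lfloor>g w\<rfloor> = R}"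
        then have w: "w \<in> B" "g w \<le> F" "nat \<lfloor>g w\<rfloor> = R" by (auto simp: BF_def)
        have "g w \<le> real (Suc R)" using w B(2)[of w] by linarith
        then show "w \<in> {w \<in> B. g w \<le> r}" using w by (simp add: r_def)
      qed
      then have "real (card {w \<in> BF. nat \<lfloor>g w\<rfloor> = R}) \<le> card {w \<in> B. g w \<le> r}"
        using B(1) by (simp add: card_mono)
      also have "\<dots> \<le> P + Q * sqrt r" using card r by blast
      also have "\<dots> \<le> P * real (Suc R) + Q * real (Suc R)"
      proof (rule add_mono)
        show "P \<le> P * real (Suc R)" using PQ(1) mult_left_mono[of 1 "real (Suc R)" P] by simp
        have "sqrt r \<le> sqrt (real (Suc R))" by (simp add: r_def)
        also have "\<dots> \<le> real (Suc R)" by (intro real_le_lsqrt self_le_power) auto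
        finally show "Q * sqrt r \<le> Q * real (Suc R)" using PQ(2) by (rule mult_left_mono)
      qed
      finally show "real (card {w \<in> BF. nat \<lfloor>g w\<rfloor> = R}) \<le> (P + Q) * real (Suc R)" by (simp add: algebra_simps)
    qed (use x in auto)
    finally show ?thesis by (simp add: mult.assoc)
  qed
  have "(\<Sum>w\<in>BF. exp (- \<mu> * g w)) = (\<Sum>R\<le>N. \<Sum>w | w \<in> BF \<and> nat \<lfloor>g w\<rfloor> = R. exp (- \<mu> * g w))"
  proof (rule sum.group[symmetric])
    show "(\<lambda>w. nat \<lfloor>g w\<rfloor>) ` BF \<subseteq> {..N}"
      unfolding BF_def N_def by (auto intro!: nat_mono floor_mono)
  qed (use B in \<open>auto simp: BF_def\<close>)
  also have "\<dots> \<le> (\<Sum>R\<le>N. (P + Q) * (real (Suc R) * x ^ R))" by (intro sum_mono inner)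
  also have "\<dots> = (P + Q) * (\<Sum>R\<le>N. real (Suc R) * x ^ R)" by (simp add: sum_distrib_left)
  also have "\<dots> \<le> (P + Q) * (1 / (1 - x)\<^sup>2)"
  proof (rule mult_left_mono)
    have s: "(\<lambda>n. real (Suc n) * x ^ n) sums (1 / (1 - x)\<^sup>2)"
      using x by (intro geometric_deriv_sums) auto
    have "(\<Sum>R\<le>N. real (Suc R) * x ^ R) \<le> suminf (\<lambda>n. real (Suc n) * x ^ n)"
      using s x by (intro sum_le_suminf) (auto simp: sums_iff)
    then show "(\<Sum>R\<le>N. real (Suc R) * x ^ R) \<le> 1 / (1 - x)\<^sup>2" using s by (simp add: sums_iff)
  qed (use PQ in auto)
  finally show ?thesis by (simp add: BF_def x_def)
qed

text \<open>Since \<open>exp (- 2 * x) \<le> 1 - x\<close> for \<open>x\<close> in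
  \<open>[0, 1/2]\<close>, a factor \<open>exp (- \<mu> * g / 2)\<close> is dominated by one term of
  the moment. At medium energy the other half of the exponent remains available as a saving.\<close>

lemma exp_le_one_minus_power:
  fixes g m \<mu> :: real
  assumes "0 \<le> g" "g \<le> m / 2" "0 < m" "8 * real k \<le> \<mu> * m"
  shows "exp (- \<mu> * g / 2) \<le> (1 - g / m) ^ (2 * k)"
proof -
  define x where "x = g / m"
  have x: "0 \<le> x" "x \<le> 1/2" using assms by (auto simp: x_def field_simps)
  have "1 \<le> (1 + 2 * x) * (1 - x)"
    using mult_nonneg_nonneg[of x "1 - 2 * x"] x by (simp add: algebra_simps)
  also have "\<dots> \<le> exp (2 * x) * (1 - x)"
    using exp_ge_add_one_self[of "2 * x"] x by (intro mult_right_mono) auto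
  finally have "exp (- (2 * x)) \<le> 1 - x" by (simp add: exp_minus field_simps)
  then have "exp (- (2 * x)) ^ (2 * k) \<le> (1 - x) ^ (2 * k)" by (intro power_mono) auto
  moreover have "exp (- (2 * x)) ^ (2 * k) = exp (- (4 * real k * x))"
    by (simp flip: exp_of_nat_mult)
  moreover have "exp (- \<mu> * g / 2) \<le> exp (- (4 * real k * x))"
  proof -
    have "8 * real k * x \<le> \<mu> * m * x" using assms x by (intro mult_right_mono) auto
    also have "\<dots> = \<mu> * g" using assms by (simp add: x_def)
    finally show ?thesis by simp
  qed
  ultimately show ?thesis unfolding x_def by linarith
qed

text \<open>A sum over the grid, not a mean: by orthogonality it is \<open>p\<^sup>2\<close> times
  the proportion of index tuples that are relations.\<close>

definition moment :: "nat \<Rightarrow> nat \<Rightarrow> (nat \<Rightarrow> int \<times> int) \<Rightarrow> nat set \<Rightarrow> real" where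
  "moment p k a S = (\<Sum>w\<in>grid p. (cmod (\<Sum>j\<in>S. chr p (dotp (a j) w)) / card S) ^ (2 * k))"

lemma one_minus_energy_le:
  assumes "finite S" "S \<noteq> {}"
  shows "1 - energy p a S w / card S \<le> cmod (\<Sum>j\<in>S. chr p (dotp (a j) w)) / card S"
proof -
  have "card S - energy p a S w = Re (\<Sum>j\<in>S. chr p (dotp (a j) w))"
    by (simp add: energy_def sum_subtractf)
  also have "\<dots> \<le> cmod (\<Sum>j\<in>S. chr p (dotp (a j) w))" by (rule complex_Re_le_cmod)
  finally have "(card S - energy p a S w) / card S \<le> cmod (\<Sum>j\<in>S. chr p (dotp (a j) w)) / card S"
    by (rule divide_right_mono) simp
  then show ?thesis using assms by (simp add: diff_divide_distrib)
qed

text \<open>Three ranges of the energy \<open>g\<close>. Up to \<open>F\<close>, the moment bounds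
  the size of the sublevel set and the growth estimate saves \<open>sqrt F\<close>. Between
  \<open>F\<close> and \<open>m / 2\<close>, half of the exponential goes into the moment and the
  other half supplies the saving. Above \<open>m / 2\<close> the trivial bound suffices.\<close>

lemma sum_exp_energy_le:
  fixes \<mu> :: real
  assumes p: "prime p" and S: "finite S" "\<And>j. j \<in> S \<Longrightarrow> \<not> pdvd p (a j)"
    and \<mu>: "0 < \<mu>" "\<mu> \<le> 1" and k: "k \<ge> 1" and large: "8 * real k \<le> \<mu> * card S"
  shows "(\<Sum>w\<in>grid p. exp (- \<mu> * energy p a S w)) \<le>
     p / (1 - exp (- \<mu>))\<^sup>2 + (16 / (1 - exp (- \<mu>))\<^sup>2 + 4 / \<mu>) * moment p k a S / sqrt (card S / k)
     + p\<^sup>2 * exp (- \<mu> * card S / 2)"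
proof -
  have p0: "p > 0" using p prime_gt_0_nat by blast
  define m where "m = real (card S)"
  \<comment> \<open>At energy at most \<open>m / (4 * k)\<close>, Bernoulli's inequality gives
    \<open>(1 - g / m) ^ (2 * k) \<ge> 1/2\<close>, so each such residue contributes at least 1/2 to
    the moment.\<close>
  define F where "F = m / (4 * k)"
  define U where "U = moment p k a S"
  define g where "g = energy p a S"
  define c where "c = 1 / (1 - exp (- \<mu>))\<^sup>2"
  have c0: "c \<ge> 0" by (simp add: c_def)
  have m0: "m > 0" using large k \<mu> by (cases "m = 0") (auto simp: m_def)
  then have Sne: "S \<noteq> {}" by (auto simp: m_def)
  have mul: "8 * real k \<le> \<mu> * m" using large by (simp add: m_def)
  also have "\<mu> * m \<le> 1 * m" using \<mu> m0 by (intro mult_right_mono) auto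
  finally have m8: "8 * real k \<le> m" by simp
  have F1: "F \<ge> 1" "F \<le> m" "F > 0" using m8 k m0 by (auto simp: F_def field_simps)
  have U_term: "(1 - g w / m) ^ (2 * k) \<le> (cmod (\<Sum>j\<in>S. chr p (dotp (a j) w)) / card S) ^ (2 * k)"
    if "g w \<le> m" for w
    using one_minus_energy_le[OF S(1) Sne, of p a w] that m0
    by (intro power_mono) (auto simp: g_def m_def)
  have U_sub: "(\<Sum>w\<in>A. (cmod (\<Sum>j\<in>S. chr p (dotp (a j) w)) / card S) ^ (2 * k)) \<le> U" if "A \<subseteq> grid p" for A
    unfolding U_def moment_def by (rule sum_mono2) (use that in auto)
  have U0: "U \<ge> 0" unfolding U_def moment_def by (intro sum_nonneg) auto
  define TF where "TF = {w \<in> grid p. g w \<le> F}"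
  have TF: "real (card TF) \<le> 2 * U"
  proof -
    have "(\<Sum>w\<in>TF. 1/2) \<le> (\<Sum>w\<in>TF. (cmod (\<Sum>j\<in>S. chr p (dotp (a j) w)) / card S) ^ (2 * k))"
    proof (rule sum_mono)
      fix w assume "w \<in> TF"
      then have gw: "g w \<le> F" by (simp add: TF_def)
      have k4: "1 - 1 / (4 * real k) \<le> 1 - g w / m"
        using gw m0 k by (simp add: F_def field_simps)
      have "1/2 = 1 + real (2 * k) * (- 1 / (4 * real k))" using k by simp
      also have "\<dots> \<le> (1 + (- 1 / (4 * real k))) ^ (2 * k)"
        using k by (intro Bernoulli_inequality) (simp add: field_simps)
      also have "\<dots> \<le> (1 - g w / m) ^ (2 * k)"
        using k4 k by (intro power_mono) (auto simp: field_simps)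
      also have "\<dots> \<le> (cmod (\<Sum>j\<in>S. chr p (dotp (a j) w)) / card S) ^ (2 * k)"
        using U_term gw F1 by simp
      finally show "1/2 \<le> (cmod (\<Sum>j\<in>S. chr p (dotp (a j) w)) / card S) ^ (2 * k)" .
    qed
    also have "\<dots> \<le> U" by (rule U_sub) (auto simp: TF_def)
    finally show ?thesis by simp
  qed
  have part1: "(\<Sum>w\<in>TF. exp (- \<mu> * g w)) \<le> c * (p + 8 * U / sqrt F)"
  proof -
    have "(\<Sum>w\<in>TF. exp (- \<mu> * g w)) \<le> (real p + 4 / sqrt F * card TF) / (1 - exp (- \<mu>))\<^sup>2"
      unfolding TF_def
    proof (rule sum_exp_layers)
      show "real (card {w \<in> grid p. g w \<le> r}) \<le> p + 4 / sqrt F * card {w \<in> grid p. g w \<le> F} * sqrt r"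
        if r: "0 < r" "r \<le> F" for r
      proof -
        have "real (card {w \<in> grid p. g w \<le> r}) \<le> p + 4 * sqrt (r / F) * card {w \<in> grid p. g w \<le> F}"
          unfolding g_def by (rule card_sublevel[OF p S r]) (use F1 in \<open>auto simp: m_def\<close>)
        then show ?thesis by (simp add: real_sqrt_divide mult_ac)
      qed
    qed (use F1 \<mu> in \<open>auto simp: g_def energy_nonneg\<close>)
    also have "\<dots> = c * (p + 4 / sqrt F * card TF)" by (simp add: c_def)
    also have "\<dots> \<le> c * (p + 4 / sqrt F * (2 * U))"
      using c0 F1 TF by (intro mult_left_mono add_left_mono) auto
    finally show ?thesis by simp
  qed
  define MF where "MF = {w \<in> grid p. F < g w \<and> g w \<le> m / 2}"
  \<comment> \<open>Only a saving of order \<open>1 / sqrt F\<close> is needed to match the low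
    range, so \<open>exp y \<ge> y\<close> together with \<open>F \<ge> 1\<close> is enough.\<close>
  have expF: "exp (- \<mu> * F / 2) \<le> 2 / (\<mu> * sqrt F)"
  proof -
    have "\<mu> * sqrt F / 2 \<le> \<mu> * F / 2"
      using F1 \<mu> by (simp add: real_le_lsqrt self_le_power)
    also have "\<dots> \<le> exp (\<mu> * F / 2)" using exp_ge_add_one_self[of "\<mu> * F / 2"] by linarith
    finally have "\<mu> * sqrt F / 2 \<le> exp (\<mu> * F / 2)" .
    moreover have "exp (- \<mu> * F / 2) = 1 / exp (\<mu> * F / 2)" by (simp add: exp_minus field_simps)
    moreover have "1 / exp (\<mu> * F / 2) \<le> 1 / (\<mu> * sqrt F / 2)"
      using calculation(1) F1 \<mu> by (intro divide_left_mono) auto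
    ultimately show ?thesis by simp
  qed
  have part2: "(\<Sum>w\<in>MF. exp (- \<mu> * g w)) \<le> 2 / (\<mu> * sqrt F) * U"
  proof -
    have "(\<Sum>w\<in>MF. exp (- \<mu> * g w)) \<le> (\<Sum>w\<in>MF. exp (- \<mu> * F / 2) *
       (cmod (\<Sum>j\<in>S. chr p (dotp (a j) w)) / card S) ^ (2 * k))"
    proof (rule sum_mono)
      fix w assume "w \<in> MF"
      then have w: "F < g w" "g w \<le> m / 2" by (auto simp: MF_def)
      have "exp (- \<mu> * g w) = exp (- \<mu> * g w / 2) * exp (- \<mu> * g w / 2)"
        by (simp flip: exp_add)
      also have "\<dots> \<le> exp (- \<mu> * F / 2) * (1 - g w / m) ^ (2 * k)"
      proof (rule mult_mono)
        show "exp (- \<mu> * g w / 2) \<le> exp (- \<mu> * F / 2)" using w \<mu> by simp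
        show "exp (- \<mu> * g w / 2) \<le> (1 - g w / m) ^ (2 * k)"
          using w m0 mul F1 by (intro exp_le_one_minus_power) auto
      qed auto
      also have "\<dots> \<le> exp (- \<mu> * F / 2) * (cmod (\<Sum>j\<in>S. chr p (dotp (a j) w)) / card S) ^ (2 * k)"
        using U_term[of w] w m0 by (intro mult_left_mono) auto
      finally show "exp (- \<mu> * g w) \<le> exp (- \<mu> * F / 2) * (cmod (\<Sum>j\<in>S. chr p (dotp (a j) w)) / card S) ^ (2 * k)" .
    qed
    also have "\<dots> \<le> exp (- \<mu> * F / 2) * U"
      unfolding sum_distrib_left[symmetric] by (intro mult_left_mono U_sub) (auto simp: MF_def)
    also have "\<dots> \<le> 2 / (\<mu> * sqrt F) * U" using expF U0 by (rule mult_right_mono)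
    finally show ?thesis .
  qed
  define LF where "LF = {w \<in> grid p. m / 2 < g w}"
  have part3: "(\<Sum>w\<in>LF. exp (- \<mu> * g w)) \<le> p\<^sup>2 * exp (- \<mu> * m / 2)"
  proof -
    have "(\<Sum>w\<in>LF. exp (- \<mu> * g w)) \<le> (\<Sum>w\<in>LF. exp (- \<mu> * m / 2))"
      using \<mu> by (intro sum_mono) (auto simp: LF_def)
    also have "\<dots> \<le> (\<Sum>w\<in>grid p. exp (- \<mu> * m / 2))"
      by (intro sum_mono2) (auto simp: LF_def)
    finally show ?thesis by (simp add: card_grid)
  qed
  have F2: "F \<le> m / 2" using m8 k m0 by (simp add: F_def field_simps)
  have "grid p = (TF \<union> MF) \<union> LF" using F2 by (auto simp: TF_def MF_def LF_def)
  then have "(\<Sum>w\<in>grid p. exp (- \<mu> * g w)) = (\<Sum>w\<in>(TF \<union> MF) \<union> LF. exp (- \<mu> * g w))" by simp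
  also have "\<dots> = (\<Sum>w\<in>TF. exp (- \<mu> * g w)) + (\<Sum>w\<in>MF. exp (- \<mu> * g w)) + (\<Sum>w\<in>LF. exp (- \<mu> * g w))"
    using F2 by (subst sum.union_disjoint; (subst sum.union_disjoint)?) (auto simp: TF_def MF_def LF_def)
  also have "\<dots> \<le> c * (p + 8 * U / sqrt F) + 2 / (\<mu> * sqrt F) * U + p\<^sup>2 * exp (- \<mu> * m / 2)"
    using part1 part2 part3 by (intro add_mono)
  also have "sqrt F = sqrt (m / k) / 2"
    by (simp add: F_def real_sqrt_divide real_sqrt_mult)
  also have "c * (p + 8 * U / (sqrt (m / k) / 2)) + 2 / (\<mu> * (sqrt (m / k) / 2)) * U + p\<^sup>2 * exp (- \<mu> * m / 2)
    = p * c + (16 * c + 4 / \<mu>) * U / sqrt (m / k) + p\<^sup>2 * exp (- \<mu> * m / 2)"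
    using m0 k \<mu> by (simp add: field_simps)
  finally show ?thesis by (simp add: c_def U_def m_def g_def)
qed

section \<open>Additive relations and rich vectors\<close>

definition half_sign :: "nat \<Rightarrow> nat \<Rightarrow> int" where
  "half_sign k t = (if t < k then 1 else -1)"

definition signed_sum :: "nat \<Rightarrow> (nat \<Rightarrow> int \<times> int) \<Rightarrow> (nat \<Rightarrow> nat) \<Rightarrow> int \<times> int" where
  "signed_sum k a r =
     (\<Sum>t<2*k. half_sign k t * fst (a (r t)), \<Sum>t<2*k. half_sign k t * snd (a (r t)))"

definition relations :: "nat \<Rightarrow> nat \<Rightarrow> (nat \<Rightarrow> int \<times> int) \<Rightarrow> nat set \<Rightarrow> (nat \<Rightarrow> nat) set" where
  "relations p k a S = {r \<in> {..<2*k} \<rightarrow>\<^sub>E S. pdvd p (signed_sum k a r)}"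

text \<open>Expand \<open>z ^ k * cnj z ^ k\<close> over tuples: conjugation puts the sign -1 on the
  last \<open>k\<close> positions, and summing over \<open>w\<close> keeps exactly the tuples whose
  signed sum vanishes modulo \<open>p\<close>.\<close>

lemma sum_norm_power_eq_card_relations:
  assumes "p > 0" "finite S"
  shows "(\<Sum>w\<in>grid p. cmod (\<Sum>j\<in>S. chr p (dotp (a j) w)) ^ (2 * k)) = p\<^sup>2 * card (relations p k a S)"
proof -
  have expand: "complex_of_real (cmod (\<Sum>j\<in>S. chr p (dotp (a j) w)) ^ (2 * k))
      = (\<Sum>r\<in>{..<2*k} \<rightarrow>\<^sub>E S. chr p (dotp (signed_sum k a r) w))" for w
  proof -
    define z where "z = (\<Sum>j\<in>S. chr p (dotp (a j) w))"
    have "complex_of_real (cmod z ^ (2 * k)) = (z * cnj z) ^ k"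
      by (simp only: power_mult of_real_power flip: complex_norm_square)
    also have "\<dots> = (\<Prod>t<k. z) * (\<Prod>t=k..<2*k. cnj z)" by (simp add: power_mult_distrib)
    also have "\<dots> = (\<Prod>t<k. if t < k then z else cnj z) * (\<Prod>t=k..<2*k. if t < k then z else cnj z)"
      by simp
    also have "\<dots> = (\<Prod>t<2*k. if t < k then z else cnj z)"
      by (subst prod.union_disjoint[symmetric]) (auto intro!: prod.cong)
    also have "\<dots> = (\<Prod>t<2*k. \<Sum>j\<in>S. chr p (half_sign k t * dotp (a j) w))"
      by (intro prod.cong) (auto simp: z_def half_sign_def chr_minus)
    also have "\<dots> = (\<Sum>r\<in>{..<2*k} \<rightarrow>\<^sub>E S. \<Prod>t<2*k. chr p (half_sign k t * dotp (a (r t)) w))"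
      using assms by (subst prod_sum_PiE) auto
    also have "\<dots> = (\<Sum>r\<in>{..<2*k} \<rightarrow>\<^sub>E S. chr p (dotp (signed_sum k a r) w))"
      by (intro sum.cong refl)
        (simp add: chr_sum[symmetric] dotp_def signed_sum_def sum_distrib_left sum_distrib_right sum.distrib algebra_simps)
    finally show ?thesis by (simp add: z_def)
  qed
  have fin: "finite ({..<2*k} \<rightarrow>\<^sub>E S)" using assms by (intro finite_PiE) auto
  have "complex_of_real (\<Sum>w\<in>grid p. cmod (\<Sum>j\<in>S. chr p (dotp (a j) w)) ^ (2 * k))
      = (\<Sum>w\<in>grid p. \<Sum>r\<in>{..<2*k} \<rightarrow>\<^sub>E S. chr p (dotp (signed_sum k a r) w))"
    by (simp only: of_real_sum expand)
  also have "\<dots> = (\<Sum>r\<in>{..<2*k} \<rightarrow>\<^sub>E S. \<Sum>w\<in>grid p. chr p (dotp (signed_sum k a r) w))"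
    by (rule sum.swap)
  also have "\<dots> = (\<Sum>r\<in>{..<2*k} \<rightarrow>\<^sub>E S. if pdvd p (signed_sum k a r) then of_nat p ^ 2 else 0)"
    by (simp add: sum_chr_grid[OF assms(1)])
  also have "\<dots> = (\<Sum>r\<in>relations p k a S. of_nat p ^ 2)"
    unfolding relations_def using fin by (rule sum.inter_filter[symmetric])
  also have "\<dots> = complex_of_real (p\<^sup>2 * card (relations p k a S))" by simp
  finally show ?thesis by (simp only: of_real_eq_iff)
qed

lemma moment_eq_card_relations:
  assumes "p > 0" "finite S"
  shows "moment p k a S = p\<^sup>2 * card (relations p k a S) / card S ^ (2 * k)"
  using sum_norm_power_eq_card_relations[OF assms, of a k]
  by (simp add: moment_def power_divide flip: sum_divide_distrib)

text \<open>Pad the image of \<open>r\<close> to a set of exactly \<open>d\<close> elements, which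
  \<open>d \<le> card S\<close> permits, and take a union bound over such sets.\<close>

lemma card_few_values:
  assumes I: "finite I" and S: "finite S" and d: "d \<le> card S"
  shows "card {r \<in> I \<rightarrow>\<^sub>E S. card (r ` I) \<le> d} \<le> (card S choose d) * d ^ card I"
proof -
  define X where "X = {D. D \<subseteq> S \<and> card D = d}"
  have finX: "finite X" using S by (simp add: X_def)
  have "{r \<in> I \<rightarrow>\<^sub>E S. card (r ` I) \<le> d} \<subseteq> (\<Union>D\<in>X. I \<rightarrow>\<^sub>E D)"
  proof
    fix r assume r: "r \<in> {r \<in> I \<rightarrow>\<^sub>E S. card (r ` I) \<le> d}"
    then have "r ` I \<subseteq> S" by auto
    then obtain D where D: "r ` I \<subseteq> D" "D \<subseteq> S" "card D = d"
      using exists_subset_between[of "r ` I" d S] r d S by auto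
    then have "r \<in> I \<rightarrow>\<^sub>E D" using r by (auto simp: PiE_def)
    then show "r \<in> (\<Union>D\<in>X. I \<rightarrow>\<^sub>E D)" using D by (auto simp: X_def)
  qed
  moreover have fin: "finite (I \<rightarrow>\<^sub>E D)" if "D \<in> X" for D
    using that I S by (intro finite_PiE) (auto simp: X_def intro: finite_subset)
  ultimately have "card {r \<in> I \<rightarrow>\<^sub>E S. card (r ` I) \<le> d} \<le> card (\<Union>D\<in>X. I \<rightarrow>\<^sub>E D)"
    using finX by (intro card_mono) auto
  also have "\<dots> \<le> (\<Sum>D\<in>X. card (I \<rightarrow>\<^sub>E D))" using finX by (rule card_UN_le)
  also have "\<dots> = (\<Sum>D\<in>X. d ^ card I)"
    using I by (intro sum.cong) (auto simp: X_def card_PiE)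
  also have "\<dots> = (card S choose d) * d ^ card I"
    using n_subsets[OF S, of d] by (simp add: X_def)
  finally show ?thesis .
qed

section \<open>Indices that occur exactly once in a tuple\<close>

definition uniques :: "nat \<Rightarrow> (nat \<Rightarrow> nat) \<Rightarrow> nat set" where
  "uniques k r = {j \<in> r ` {..<2*k}. card {t \<in> {..<2*k}. r t = j} = 1}"

lemma finite_uniques [simp]: "finite (uniques k r)"
  by (simp add: uniques_def)

lemma card_uniques_le: "card (uniques k r) \<le> 2 * k"
proof -
  have "card (uniques k r) \<le> card (r ` {..<2*k})" by (rule card_mono) (auto simp: uniques_def)
  also have "\<dots> \<le> 2 * k" using card_image_le[of "{..<2*k}" r] by simp
  finally show ?thesis .
qed

text \<open>Each value occupies at least two of the \<open>2 * k\<close> positions unless it is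
  unique, in which case it is one short.\<close>

lemma card_uniques_ge: "2 * card (r ` {..<2*k}) \<le> 2 * k + card (uniques k r)"
proof -
  let ?I = "{..<2*k}"
  have "2 * card (r ` ?I) = (\<Sum>j\<in>r ` ?I. 2)" by simp
  also have "\<dots> \<le> (\<Sum>j\<in>r ` ?I. card {t \<in> ?I. r t = j} + (if j \<in> uniques k r then 1 else 0))"
  proof (rule sum_mono)
    fix j assume j: "j \<in> r ` ?I"
    then have "{t \<in> ?I. r t = j} \<noteq> {}" by auto
    then have "card {t \<in> ?I. r t = j} \<noteq> 0" by (subst card_0_eq) auto
    moreover have "2 \<le> c + (if P then 1 else 0)" if "c \<noteq> 0" "P \<longleftrightarrow> c = 1" for c :: nat and P
      using that by auto
    moreover have "j \<in> uniques k r \<longleftrightarrow> card {t \<in> ?I. r t = j} = 1"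
      using j unfolding uniques_def by blast
    ultimately show "2 \<le> card {t \<in> ?I. r t = j} + (if j \<in> uniques k r then 1 else 0)"
      by blast
  qed
  also have "\<dots> = (\<Sum>j\<in>r ` ?I. card {t \<in> ?I. r t = j}) + card (uniques k r)"
  proof -
    have "(\<Sum>j\<in>r ` ?I. if j \<in> uniques k r then 1 else 0) = card {j \<in> r ` ?I. j \<in> uniques k r}"
      by (simp add: sum.inter_filter[symmetric])
    also have "{j \<in> r ` ?I. j \<in> uniques k r} = uniques k r" by (auto simp: uniques_def)
    finally show ?thesis by (simp only: sum.distrib)
  qed
  also have "(\<Sum>j\<in>r ` ?I. card {t \<in> ?I. r t = j}) = 2 * k"
    using sum.group[of ?I "r ` ?I" r "\<lambda>_. 1::nat"] by simp
  finally show ?thesis .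
qed

definition generic_relations :: "nat \<Rightarrow> nat \<Rightarrow> (nat \<Rightarrow> int \<times> int) \<Rightarrow> nat set \<Rightarrow> (nat \<Rightarrow> nat) set" where
  "generic_relations p k a S = {r \<in> relations p k a S. k \<le> 2 * card (uniques k r)}"

text \<open>The threshold \<open>5 * k div 4\<close> is where the count of unique indices becomes
  useful: with more distinct values than that, the number of unique ones exceeds
  \<open>2 * (5 * k / 4) - 2 * k = k / 2\<close>.\<close>

lemma card_relations_le:
  assumes S: "finite S" and d: "5 * k div 4 \<le> card S"
  shows "card (relations p k a S) \<le>
    card (generic_relations p k a S) + (card S choose (5 * k div 4)) * (5 * k div 4) ^ (2 * k)"
proof -
  define d where "d = 5 * k div 4"
  have fin: "finite ({..<2*k} \<rightarrow>\<^sub>E S)" using S by (intro finite_PiE) auto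
  have "relations p k a S \<subseteq> generic_relations p k a S \<union> {r \<in> {..<2*k} \<rightarrow>\<^sub>E S. card (r ` {..<2*k}) \<le> d}"
  proof
    fix r assume r: "r \<in> relations p k a S"
    show "r \<in> generic_relations p k a S \<union> {r \<in> {..<2*k} \<rightarrow>\<^sub>E S. card (r ` {..<2*k}) \<le> d}"
    proof (cases "card (r ` {..<2*k}) \<le> d")
      case True
      then show ?thesis using r by (simp add: relations_def)
    next
      case False
      then have "k \<le> 2 * card (uniques k r)"
        using card_uniques_ge[of r k] unfolding d_def by linarith
      then show ?thesis using r by (simp add: generic_relations_def)
    qed
  qed
  then have "card (relations p k a S) \<le>
      card (generic_relations p k a S \<union> {r \<in> {..<2*k} \<rightarrow>\<^sub>E S. card (r ` {..<2*k}) \<le> d})"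
    using fin by (intro card_mono) (auto simp: generic_relations_def relations_def)
  also have "\<dots> \<le> card (generic_relations p k a S) + card {r \<in> {..<2*k} \<rightarrow>\<^sub>E S. card (r ` {..<2*k}) \<le> d}"
    by (rule card_Un_le)
  also have "\<dots> \<le> card (generic_relations p k a S) + (card S choose d) * d ^ (2 * k)"
    using card_few_values[of "{..<2*k}" S d] S d by (simp add: d_def)
  finally show ?thesis by (simp add: d_def)
qed

lemma signed_sum_cong:
  assumes "\<And>j. j \<in> S \<Longrightarrow> a j = b j" "r \<in> {..<2*k} \<rightarrow>\<^sub>E S"
  shows "signed_sum k a r = signed_sum k b r"
proof -
  have "a (r t) = b (r t)" if "t < 2 * k" for t using assms that by auto
  then show ?thesis by (simp add: signed_sum_def)
qed

lemma generic_relations_cong: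
  assumes "\<And>j. j \<in> S \<Longrightarrow> a j = b j"
  shows "generic_relations p k a S = generic_relations p k b S"
  using signed_sum_cong[OF assms, where S = S and k = k]
  by (auto simp: generic_relations_def relations_def)

text \<open>Quantifying over all subsets of size at least \<open>s\<close> makes the property
  hereditary: deleting a coordinate of a rich vector leaves a rich vector, which drives the
  induction on \<open>card S\<close>.\<close>

definition rich_vectors :: "nat \<Rightarrow> nat \<Rightarrow> nat \<Rightarrow> real \<Rightarrow> nat set \<Rightarrow> (nat \<Rightarrow> int \<times> int) set" where
  "rich_vectors p k s \<beta> S = {a \<in> S \<rightarrow>\<^sub>E grid p. \<forall>S'\<subseteq>S. s \<le> card S' \<longrightarrow>
      \<beta> * card S' ^ (2 * k) \<le> card (generic_relations p k a S')}"

lemma finite_rich_vectors [simp]: "finite S \<Longrightarrow> finite (rich_vectors p k s \<beta> S)"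
  unfolding rich_vectors_def by (auto intro!: finite_subset[OF _ finite_PiE[of S "\<lambda>_. grid p"]])

text \<open>A relation in which the index \<open>j\<close> occurs exactly once determines \<open>a j\<close> from the other entries.\<close>

lemma card_rich_vectors_with_relation:
  assumes S: "finite S" and r: "r \<in> {..<2*k} \<rightarrow>\<^sub>E S" and j: "j \<in> uniques k r"
  shows "card {a \<in> rich_vectors p k s \<beta> S. r \<in> relations p k a S} \<le> card (rich_vectors p k s \<beta> (S - {j}))"
proof (rule card_inj_on_le[where f = "\<lambda>a. restrict a (S - {j})"])
  have jS: "j \<in> S" using j r by (auto simp: uniques_def)
  obtain t0 where t0: "{t \<in> {..<2*k}. r t = j} = {t0}"
    using j by (auto simp: uniques_def card_1_singleton_iff)
  then have t0': "t0 < 2 * k" "r t0 = j" by auto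
  show "inj_on (\<lambda>a. restrict a (S - {j})) {a \<in> rich_vectors p k s \<beta> S. r \<in> relations p k a S}"
  proof (rule inj_onI)
    fix a b
    assume a: "a \<in> {a \<in> rich_vectors p k s \<beta> S. r \<in> relations p k a S}"
      and b: "b \<in> {a \<in> rich_vectors p k s \<beta> S. r \<in> relations p k a S}"
      and eq: "restrict a (S - {j}) = restrict b (S - {j})"
    have aE: "a \<in> S \<rightarrow>\<^sub>E grid p" "b \<in> S \<rightarrow>\<^sub>E grid p" using a b by (auto simp: rich_vectors_def)
    have agree: "a i = b i" if "i \<in> S" "i \<noteq> j" for i
      using fun_cong[OF eq, of i] that by simp
    have other: "a (r t) = b (r t)" if "t \<in> {..<2*k} - {t0}" for t
    proof (rule agree)
      show "r t \<in> S" using r that by auto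
      show "r t \<noteq> j" using t0 that by blast
    qed
    have cancel: "f (a j) = f (b j)"
      if f: "int p dvd (\<Sum>t<2*k. half_sign k t * f (a (r t)))" "int p dvd (\<Sum>t<2*k. half_sign k t * f (b (r t)))"
        "f (a j) \<in> {0..<int p}" "f (b j) \<in> {0..<int p}" for f :: "int \<times> int \<Rightarrow> int"
    proof -
      have split: "(\<Sum>t<2*k. half_sign k t * f (c (r t))) =
          half_sign k t0 * f (c j) + (\<Sum>t\<in>{..<2*k} - {t0}. half_sign k t * f (c (r t)))" for c
        using t0' by (subst sum.remove[of _ t0]) auto
      have eq': "(\<Sum>t<2*k. half_sign k t * f (a (r t))) - (\<Sum>t<2*k. half_sign k t * f (b (r t)))
          = half_sign k t0 * (f (a j) - f (b j))"
        unfolding split using other by (simp add: algebra_simps)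
      have "int p dvd half_sign k t0 * (f (a j) - f (b j))"
        unfolding eq'[symmetric] using f(1,2) by (rule dvd_diff)
      \<comment> \<open>Multiplying by the sign once more removes it, since its square is 1.\<close>
      then have "int p dvd half_sign k t0 * (half_sign k t0 * (f (a j) - f (b j)))" by (rule dvd_mult)
      then have "int p dvd f (a j) - f (b j)" by (cases "t0 < k") (simp_all add: half_sign_def)
      then have "f (a j) mod int p = f (b j) mod int p" by (simp add: mod_eq_dvd_iff)
      then show ?thesis using f by simp
    qed
    have "a j \<in> grid p" "b j \<in> grid p" using aE jS by auto
    then have rng: "fst (a j) \<in> {0..<int p}" "fst (b j) \<in> {0..<int p}"
        "snd (a j) \<in> {0..<int p}" "snd (b j) \<in> {0..<int p}"
      by (auto simp: grid_def)
    have dvd_a: "int p dvd (\<Sum>t<2*k. half_sign k t * fst (a (r t)))" "int p dvd (\<Sum>t<2*k. half_sign k t * snd (a (r t)))"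
      using a by (simp_all add: relations_def signed_sum_def pdvd_def)
    have dvd_b: "int p dvd (\<Sum>t<2*k. half_sign k t * fst (b (r t)))" "int p dvd (\<Sum>t<2*k. half_sign k t * snd (b (r t)))"
      using b by (simp_all add: relations_def signed_sum_def pdvd_def)
    have "fst (a j) = fst (b j)" using dvd_a(1) dvd_b(1) rng(1,2) by (rule cancel)
    moreover have "snd (a j) = snd (b j)" using dvd_a(2) dvd_b(2) rng(3,4) by (rule cancel)
    ultimately have "a j = b j" by (simp add: prod_eq_iff)
    then show "a = b" using agree aE by (intro PiE_ext[of a S "\<lambda>_. grid p" b]) auto
  qed
  show "(\<lambda>a. restrict a (S - {j})) ` {a \<in> rich_vectors p k s \<beta> S. r \<in> relations p k a S}
      \<subseteq> rich_vectors p k s \<beta> (S - {j})"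
  proof clarify
    fix a assume a: "a \<in> rich_vectors p k s \<beta> S"
    have "generic_relations p k (restrict a (S - {j})) S' = generic_relations p k a S'" if "S' \<subseteq> S - {j}" for S'
      using that by (intro generic_relations_cong) auto
    then show "restrict a (S - {j}) \<in> rich_vectors p k s \<beta> (S - {j})"
      using a by (auto simp: rich_vectors_def)
  qed
qed (use S in auto)

text \<open>Count triples of a vector, a relation and a unique index. Each vector lies in at least
  \<open>\<beta> * M * k / 2\<close> triples. Each of the \<open>M\<close> tuples has at most
  \<open>2 * k\<close> unique indices, and each of these admits at most \<open>B\<close> vectors.
  The quotient is \<open>4 * B / \<beta>\<close>.\<close>

lemma card_rich_vectors_step:
  assumes S: "finite S" "S \<noteq> {}" "s \<le> card S" and k: "k \<ge> 1" and \<beta>: "\<beta> > 0"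
    and B: "\<And>j. j \<in> S \<Longrightarrow> real (card (rich_vectors p k s \<beta> (S - {j}))) \<le> B"
  shows "real (card (rich_vectors p k s \<beta> S)) \<le> 4 / \<beta> * B"
proof -
  define Z where "Z = rich_vectors p k s \<beta> S"
  define R where "R = {..<2*k} \<rightarrow>\<^sub>E S"
  define M where "M = real (card S) ^ (2 * k)"
  have finZ: "finite Z" using S by (simp add: Z_def)
  have finR: "finite R" unfolding R_def using S by (intro finite_PiE) auto
  have cardR: "real (card R) = M" by (simp add: R_def M_def card_PiE)
  have M0: "M > 0" using S by (simp add: M_def card_gt_0_iff)
  have "real (card Z) * (\<beta> * M * (k / 2)) = (\<Sum>a\<in>Z. \<beta> * M * (k / 2))" by simp
  also have "\<dots> \<le> (\<Sum>a\<in>Z. \<Sum>r | r \<in> R \<and> r \<in> relations p k a S. real (card (uniques k r)))"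
  proof (rule sum_mono)
    fix a assume a: "a \<in> Z"
    have "\<beta> * M \<le> card (generic_relations p k a S)"
      using a S by (auto simp: Z_def M_def rich_vectors_def)
    then have "\<beta> * M * (k / 2) \<le> card (generic_relations p k a S) * (k / 2)" by (intro mult_right_mono) auto
    also have "\<dots> = (\<Sum>r\<in>generic_relations p k a S. k / 2)" by simp
    also have "\<dots> \<le> (\<Sum>r\<in>generic_relations p k a S. real (card (uniques k r)))"
      by (intro sum_mono) (auto simp: generic_relations_def)
    also have "\<dots> \<le> (\<Sum>r | r \<in> R \<and> r \<in> relations p k a S. real (card (uniques k r)))"
      using finR by (intro sum_mono2) (auto simp: R_def generic_relations_def relations_def)
    finally show "\<beta> * M * (k / 2) \<le> (\<Sum>r | r \<in> R \<and> r \<in> relations p k a S. real (card (uniques k r)))" .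
  qed
  also have "\<dots> = (\<Sum>r\<in>R. \<Sum>a | a \<in> Z \<and> r \<in> relations p k a S. real (card (uniques k r)))"
    using finZ finR by (rule sum.swap_restrict)
  also have "\<dots> \<le> (\<Sum>r\<in>R. real (2 * k) * B)"
  proof (rule sum_mono)
    fix r assume r: "r \<in> R"
    define z where "z = card {a \<in> Z. r \<in> relations p k a S}"
    have "(\<Sum>a | a \<in> Z \<and> r \<in> relations p k a S. real (card (uniques k r))) = card (uniques k r) * real z"
      by (simp add: z_def)
    also have "\<dots> = (\<Sum>j\<in>uniques k r. real z)" by simp
    also have "\<dots> \<le> (\<Sum>j\<in>uniques k r. B)"
    proof (rule sum_mono)
      fix j assume j: "j \<in> uniques k r"
      have "j \<in> S" using j r by (auto simp: uniques_def R_def)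
      moreover have "z \<le> card (rich_vectors p k s \<beta> (S - {j}))"
        unfolding z_def Z_def using S r j by (intro card_rich_vectors_with_relation) (auto simp: R_def)
      ultimately show "real z \<le> B" using B[of j] by linarith
    qed
    also have "\<dots> = card (uniques k r) * B" by simp
    also have "\<dots> \<le> real (2 * k) * B"
    proof (rule mult_right_mono)
      show "real (card (uniques k r)) \<le> real (2 * k)" using card_uniques_le of_nat_le_iff by blast
      show "0 \<le> B" using S(2) B by (meson equals0I of_nat_0_le_iff order_trans)
    qed
    finally show "(\<Sum>a | a \<in> Z \<and> r \<in> relations p k a S. real (card (uniques k r))) \<le> real (2 * k) * B" .
  qed
  also have "\<dots> = M * (2 * k) * B" using cardR by simp
  finally have "(M * k / 2) * (card Z * \<beta>) \<le> (M * k / 2) * (4 * B)" by (simp add: mult_ac)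
  moreover have "M * k / 2 > 0" using M0 k by simp
  ultimately have "card Z * \<beta> \<le> 4 * B" by (simp only: mult_le_cancel_left_pos)
  then show ?thesis using \<beta> by (simp add: Z_def field_simps)
qed

text \<open>Coordinates are removed until \<open>s\<close> are left, below which richness says
  nothing; the remaining ones are counted trivially by \<open>p ^ (2 * s)\<close>.\<close>

lemma card_rich_vectors:
  assumes k: "k \<ge> 1" and \<beta>: "\<beta> > 0" and S: "finite S" "s \<le> card S"
  shows "real (card (rich_vectors p k s \<beta> S)) \<le> real p ^ (2 * s) * (4 / \<beta>) ^ (card S - s)"
  using S
proof (induction "card S - s" arbitrary: S)
  case 0
  have "card (rich_vectors p k s \<beta> S) \<le> card (S \<rightarrow>\<^sub>E grid p)"
    using 0 by (intro card_mono finite_PiE) (auto simp: rich_vectors_def)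
  also have "\<dots> = p ^ (2 * s)" using 0 by (simp add: card_PiE card_grid power_mult)
  finally show ?case using 0 by (metis mult.right_neutral of_nat_le_iff of_nat_power power_0)
next
  case (Suc x)
  have "real (card (rich_vectors p k s \<beta> S)) \<le> 4 / \<beta> * (real p ^ (2 * s) * (4 / \<beta>) ^ x)"
  proof (rule card_rich_vectors_step)
    fix j assume j: "j \<in> S"
    have c: "card (S - {j}) = card S - 1" using j Suc by simp
    have x: "x = card (S - {j}) - s" using c Suc.hyps(2) by simp
    have "s \<le> card (S - {j})" using c Suc.hyps(2) by linarith
    then show "real (card (rich_vectors p k s \<beta> (S - {j}))) \<le> real p ^ (2 * s) * (4 / \<beta>) ^ x"
      using Suc.hyps(1)[OF x] Suc.prems unfolding x[symmetric] by simp
  qed (use Suc k \<beta> in auto)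
  then show ?case unfolding Suc.hyps(2)[symmetric] by (simp add: mult_ac)
qed

section \<open>Lazy walks on the Gaussian integers\<close>

text \<open>The probability of the pattern \<open>\<eta>\<close> for independent signs that are 0
  with probability \<open>1 - \<mu>\<close> and each of 1, -1 with probability
  \<open>\<mu> / 2\<close>. Finite weighted sums stand in for a measure.\<close>

definition lazy_weight :: "real \<Rightarrow> nat \<Rightarrow> (nat \<Rightarrow> int) \<Rightarrow> real" where
  "lazy_weight \<mu> n \<eta> = (\<Prod>j<n. if \<eta> j = 0 then 1 - \<mu> else \<mu> / 2)"

definition lazy_steps :: "nat \<Rightarrow> (nat \<Rightarrow> int) set" where
  "lazy_steps n = {..<n} \<rightarrow>\<^sub>E {-1, 0, 1}"

definition walk_end :: "nat \<Rightarrow> (nat \<Rightarrow> int \<times> int) \<Rightarrow> (nat \<Rightarrow> int) \<Rightarrow> int \<times> int" where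
  "walk_end n v \<eta> = (\<Sum>j<n. \<eta> j * fst (v j), \<Sum>j<n. \<eta> j * snd (v j))"

lemma finite_lazy_steps [simp]: "finite (lazy_steps n)"
  unfolding lazy_steps_def by (intro finite_PiE) auto

lemma lazy_weight_nonneg: "0 \<le> \<mu> \<Longrightarrow> \<mu> \<le> 1 \<Longrightarrow> lazy_weight \<mu> n \<eta> \<ge> 0"
  unfolding lazy_weight_def by (intro prod_nonneg) auto

lemma cis_sum: "cis (\<Sum>j\<in>J. f j) = (\<Prod>j\<in>J. cis (f j))"
  by (induction J rule: infinite_finite_induct) (auto simp: cis_mult[symmetric])

text \<open>\<open>1 - \<mu> * (1 - cos x)\<close> is the characteristic function of one lazy sign,
  so the product is that of the whole walk. It is used both for angles modulo \<open>p\<close> and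
  for Gaussian angles.\<close>

lemma prod_lazy_cos:
  "complex_of_real (\<Prod>j<n. 1 - \<mu> * (1 - cos (\<theta> j)))
     = (\<Sum>\<eta>\<in>lazy_steps n. of_real (lazy_weight \<mu> n \<eta>) * cis (\<Sum>j<n. of_int (\<eta> j) * \<theta> j))"
proof -
  have factor: "complex_of_real (1 - \<mu> * (1 - cos x))
      = (\<Sum>e\<in>{-1, 0, 1::int}. of_real (if e = 0 then 1 - \<mu> else \<mu> / 2) * cis (of_int e * x))" for x
    by (simp add: complex_eq_iff algebra_simps)
  have "complex_of_real (\<Prod>j<n. 1 - \<mu> * (1 - cos (\<theta> j)))
      = (\<Prod>j<n. \<Sum>e\<in>{-1, 0, 1::int}. of_real (if e = 0 then 1 - \<mu> else \<mu> / 2) * cis (of_int e * \<theta> j))"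
    by (simp only: of_real_prod factor)
  also have "\<dots> = (\<Sum>\<eta>\<in>lazy_steps n. \<Prod>j<n. of_real (if \<eta> j = 0 then 1 - \<mu> else \<mu> / 2) * cis (of_int (\<eta> j) * \<theta> j))"
    unfolding lazy_steps_def by (rule prod_sum_PiE) auto
  finally show ?thesis by (simp only: prod.distrib cis_sum lazy_weight_def of_real_prod)
qed

lemma dotp_walk_end: "dotp (walk_end n v \<eta>) w = (\<Sum>j<n. \<eta> j * dotp (v j) w)"
  by (simp add: dotp_def walk_end_def sum_distrib_left sum_distrib_right sum.distrib algebra_simps)

lemma walk_point_mass_le:
  assumes p: "p > 0" and \<mu>: "0 \<le> \<mu>" "\<mu> \<le> 1/2" and S: "S \<subseteq> {..<n}"
  shows "(\<Sum>\<eta> | \<eta> \<in> lazy_steps n \<and> walk_end n v \<eta> = h. lazy_weight \<mu> n \<eta>)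
    \<le> (\<Sum>w\<in>grid p. exp (- \<mu> * energy p v S w)) / p\<^sup>2"
proof -
  define q where "q = lazy_weight \<mu> n"
  have q0: "q \<eta> \<ge> 0" for \<eta> unfolding q_def using \<mu> by (intro lazy_weight_nonneg) auto
  define X where "X w j = 1 - \<mu> * (1 - cos (2 * pi * of_int (dotp (v j) w) / of_nat p))" for w j
  have X: "0 \<le> X w j" "X w j \<le> 1" "X w j \<le> exp (- \<mu> * (1 - Re (chr p (dotp (v j) w))))" for w j
  proof -
    define c where "c = cos (2 * pi * of_int (dotp (v j) w) / of_nat p)"
    have c: "-1 \<le> c" "c \<le> 1" by (auto simp: c_def)
    have "\<mu> * (1 - c) \<le> (1/2) * 2" using \<mu> c by (intro mult_mono) auto
    then show "0 \<le> X w j" by (simp add: X_def c_def)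
    show "X w j \<le> 1" using \<mu> by (simp add: X_def)
    show "X w j \<le> exp (- \<mu> * (1 - Re (chr p (dotp (v j) w))))"
      using exp_ge_add_one_self[of "- \<mu> * (1 - c)"] by (simp add: X_def c_def Re_chr)
  qed
  have prodX: "(\<Prod>j<n. X w j) \<le> exp (- \<mu> * energy p v S w)" for w
  proof -
    have "(\<Prod>j<n. X w j) = (\<Prod>j\<in>{..<n} - S. X w j) * (\<Prod>j\<in>S. X w j)"
      using S by (simp add: prod.subset_diff)
    also have "\<dots> \<le> 1 * (\<Prod>j\<in>S. exp (- \<mu> * (1 - Re (chr p (dotp (v j) w)))))"
      using X by (intro mult_mono prod_mono prod_le_1 prod_nonneg) auto
    also have "\<dots> = exp (- \<mu> * energy p v S w)"
      unfolding energy_def sum_distrib_left using S finite_subset by (subst exp_sum) auto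
    finally show ?thesis .
  qed
  have chr_walk: "chr p (dotp (walk_end n v \<eta>) w)
      = cis (\<Sum>j<n. of_int (\<eta> j) * (2 * pi * of_int (dotp (v j) w) / of_nat p))" for \<eta> w
  proof -
    have "2 * pi * of_int (\<Sum>j<n. \<eta> j * dotp (v j) w) / real p
        = (\<Sum>j<n. of_int (\<eta> j) * (2 * pi * of_int (dotp (v j) w) / of_nat p))"
      by (simp add: sum_distrib_left sum_divide_distrib mult_ac)
    then show ?thesis unfolding dotp_walk_end chr_def by metis
  qed
  have fourier: "(\<Sum>\<eta>\<in>lazy_steps n. complex_of_real (q \<eta>) * chr p (dotp (walk_end n v \<eta>) w)) = of_real (\<Prod>j<n. X w j)" for w
    unfolding chr_walk q_def X_def by (rule prod_lazy_cos[symmetric])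
  have "complex_of_real (\<Sum>\<eta> | \<eta> \<in> lazy_steps n \<and> pdvd p (walk_end n v \<eta> - h). q \<eta>) * of_nat p ^ 2
     = (\<Sum>\<eta>\<in>lazy_steps n. complex_of_real (q \<eta>) * (if pdvd p (walk_end n v \<eta> - h) then of_nat p ^ 2 else 0))"
    unfolding of_real_sum sum_distrib_right
    by (subst sum.inter_filter) (auto intro!: sum.cong)
  also have "\<dots> = (\<Sum>\<eta>\<in>lazy_steps n. complex_of_real (q \<eta>) * (\<Sum>w\<in>grid p. chr p (dotp (walk_end n v \<eta> - h) w)))"
    by (simp only: sum_chr_grid[OF p])
  also have "\<dots> = (\<Sum>w\<in>grid p. \<Sum>\<eta>\<in>lazy_steps n. complex_of_real (q \<eta>) * chr p (dotp (walk_end n v \<eta> - h) w))"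
    by (subst sum.swap) (simp only: sum_distrib_left)
  also have "\<dots> = (\<Sum>w\<in>grid p. chr p (- dotp h w) * of_real (\<Prod>j<n. X w j))"
  proof (rule sum.cong[OF refl])
    fix w
    have "chr p (dotp (u - h) w) = chr p (- dotp h w) * chr p (dotp u w)" for u
      unfolding chr_add[symmetric] by (simp add: dotp_def algebra_simps)
    then show "(\<Sum>\<eta>\<in>lazy_steps n. complex_of_real (q \<eta>) * chr p (dotp (walk_end n v \<eta> - h) w))
        = chr p (- dotp h w) * of_real (\<Prod>j<n. X w j)"
      unfolding fourier[symmetric] by (simp add: sum_distrib_left mult_ac)
  qed
  finally have eq: "complex_of_real (\<Sum>\<eta> | \<eta> \<in> lazy_steps n \<and> pdvd p (walk_end n v \<eta> - h). q \<eta>) * of_nat p ^ 2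
     = (\<Sum>w\<in>grid p. chr p (- dotp h w) * of_real (\<Prod>j<n. X w j))" .
  have "(\<Sum>\<eta> | \<eta> \<in> lazy_steps n \<and> pdvd p (walk_end n v \<eta> - h). q \<eta>) * real p ^ 2
     = cmod (complex_of_real (\<Sum>\<eta> | \<eta> \<in> lazy_steps n \<and> pdvd p (walk_end n v \<eta> - h). q \<eta>) * of_nat p ^ 2)"
    using q0 by (simp add: norm_mult norm_power sum_nonneg del: of_real_sum)
  also have "\<dots> \<le> (\<Sum>w\<in>grid p. cmod (chr p (- dotp h w) * of_real (\<Prod>j<n. X w j)))"
    unfolding eq by (rule norm_sum)
  also have "\<dots> = (\<Sum>w\<in>grid p. (\<Prod>j<n. X w j))"
    using X(1) by (intro sum.cong refl) (simp add: norm_mult prod_nonneg del: of_real_prod)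
  also have "\<dots> \<le> (\<Sum>w\<in>grid p. exp (- \<mu> * energy p v S w))" by (intro sum_mono prodX)
  finally have "(\<Sum>\<eta> | \<eta> \<in> lazy_steps n \<and> pdvd p (walk_end n v \<eta> - h). q \<eta>)
     \<le> (\<Sum>w\<in>grid p. exp (- \<mu> * energy p v S w)) / p\<^sup>2"
    using p by (simp add: field_simps)
  \<comment> \<open>Hitting \<open>h\<close> implies hitting it modulo \<open>p\<close>, and the
    weights are nonnegative; wrapping around can only increase the mass.\<close>
  moreover have "(\<Sum>\<eta> | \<eta> \<in> lazy_steps n \<and> walk_end n v \<eta> = h. q \<eta>)
     \<le> (\<Sum>\<eta> | \<eta> \<in> lazy_steps n \<and> pdvd p (walk_end n v \<eta> - h). q \<eta>)"
    using q0 by (intro sum_mono2) (auto simp: pdvd_def)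
  ultimately show ?thesis by (simp add: q_def)
qed

section \<open>Gaussian sums over the lattice\<close>

lemma sum_gaussian_int_le:
  assumes "b > 0"
  shows "(\<Sum>a\<in>{- int L..int L}. exp (- b * (real_of_int a)\<^sup>2)) \<le> 2 / (1 - exp (- b))"
proof -
  define x where "x = exp (- b)"
  have x: "0 < x" "x < 1" using assms by (auto simp: x_def)
  have le: "exp (- b * (real_of_int a)\<^sup>2) \<le> x ^ nat \<bar>a\<bar>" for a
  proof -
    \<comment> \<open>\<open>\<bar>a\<bar> \<le> a\<^sup>2\<close> for integers reduces the Gaussian
      to two geometric series, one per sign.\<close>
    have "\<bar>a\<bar> * 1 \<le> \<bar>a\<bar> * \<bar>a\<bar>"
    proof (cases "a = 0")
      case False
      then show ?thesis by (intro mult_left_mono) linarith+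
    qed simp
    then have "\<bar>a\<bar> \<le> a\<^sup>2" by (simp add: power2_eq_square)
    then have "real (nat \<bar>a\<bar>) \<le> (real_of_int a)\<^sup>2"
      by (metis abs_ge_zero of_int_le_iff of_int_power of_nat_nat)
    then have "exp (- b * (real_of_int a)\<^sup>2) \<le> exp (real (nat \<bar>a\<bar>) * - b)" using assms by simp
    then show ?thesis unfolding x_def exp_of_nat_mult .
  qed
  have geo: "(\<Sum>i\<le>L. x ^ i) \<le> 1 / (1 - x)"
  proof -
    have "(\<Sum>i\<le>L. x ^ i) \<le> (\<Sum>i. x ^ i)" using x by (intro sum_le_suminf summable_geometric) auto
    then show ?thesis using x by (simp add: suminf_geometric)
  qed
  have cover: "{- int L..int L} = int ` {..L} \<union> (\<lambda>i. - int i) ` {..L}"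
  proof
    show "{- int L..int L} \<subseteq> int ` {..L} \<union> (\<lambda>i. - int i) ` {..L}"
    proof
      fix a assume a: "a \<in> {- int L..int L}"
      then have "nat \<bar>a\<bar> \<in> {..L}" by auto
      moreover have "a = int (nat \<bar>a\<bar>) \<or> a = - int (nat \<bar>a\<bar>)" by auto
      ultimately show "a \<in> int ` {..L} \<union> (\<lambda>i. - int i) ` {..L}" by blast
    qed
  qed auto
  have "(\<Sum>a\<in>{- int L..int L}. exp (- b * (real_of_int a)\<^sup>2)) \<le> (\<Sum>a\<in>{- int L..int L}. x ^ nat \<bar>a\<bar>)"
    by (intro sum_mono le)
  also have "\<dots> = (\<Sum>a\<in>int ` {..L} \<union> (\<lambda>i. - int i) ` {..L}. x ^ nat \<bar>a\<bar>)"
    by (simp only: cover)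
  also have "\<dots>
      \<le> (\<Sum>a\<in>int ` {..L}. x ^ nat \<bar>a\<bar>) + (\<Sum>a\<in>(\<lambda>i. - int i) ` {..L}. x ^ nat \<bar>a\<bar>)"
    using x by (subst sum_Un) (auto intro!: sum_nonneg)
  also have "\<dots> = (\<Sum>i\<le>L. x ^ i) + (\<Sum>i\<le>L. x ^ i)"
    by (subst (1 2) sum.reindex) (auto simp: inj_on_def)
  also have "\<dots> \<le> 2 / (1 - x)" using geo by simp
  finally show ?thesis by (simp add: x_def)
qed

lemma sum_gaussian_lattice_le:
  fixes H :: "(int \<times> int) set"
  assumes b: "b > 0" and H: "finite H"
  shows "(\<Sum>h\<in>H. exp (- b * ((real_of_int (fst h))\<^sup>2 + (real_of_int (snd h))\<^sup>2))) \<le> (2 / (1 - exp (- b)))\<^sup>2"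
proof -
  define f where "f = (\<lambda>a. exp (- b * (real_of_int a)\<^sup>2))"
  have "\<exists>L. H \<subseteq> {- int L..int L} \<times> {- int L..int L}"
    using H
  proof (induction H rule: finite_induct)
    case (insert h H)
    then obtain L where L: "H \<subseteq> {- int L..int L} \<times> {- int L..int L}" by blast
    define L' where "L' = L + nat \<bar>fst h\<bar> + nat \<bar>snd h\<bar>"
    have "insert h H \<subseteq> {- int L'..int L'} \<times> {- int L'..int L'}"
      using L by (force simp: L'_def mem_Times_iff)
    then show ?case by blast
  qed auto
  then obtain L where L: "H \<subseteq> {- int L..int L} \<times> {- int L..int L}" by blast
  have "(\<Sum>h\<in>H. exp (- b * ((real_of_int (fst h))\<^sup>2 + (real_of_int (snd h))\<^sup>2))) = (\<Sum>h\<in>H. f (fst h) * f (snd h))"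
    by (intro sum.cong refl) (simp add: f_def distrib_left flip: exp_add)
  also have "\<dots> \<le> (\<Sum>h\<in>{- int L..int L} \<times> {- int L..int L}. f (fst h) * f (snd h))"
    using L by (intro sum_mono2) (auto simp: f_def)
  also have "\<dots> = (\<Sum>a\<in>{- int L..int L}. f a)\<^sup>2"
    by (simp add: power2_eq_square sum_product sum.cartesian_product case_prod_beta)
  also have "\<dots> \<le> (2 / (1 - exp (- b)))\<^sup>2"
    using sum_gaussian_int_le[OF b, of L] by (intro power_mono) (auto simp: f_def intro!: sum_nonneg)
  finally show ?thesis .
qed

text \<open>Integrality of \<open>v\<close> enters here: the walk ends at lattice points, each of
  mass at most the same Fourier average, and the Gaussian weight sums over any set of lattice points
  to a bound free of \<open>n\<close> and \<open>v\<close>.\<close>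

lemma walk_gaussian_le:
  assumes p: "p > 0" and \<mu>: "0 \<le> \<mu>" "\<mu> \<le> 1/2" and S: "S \<subseteq> {..<n}" and b: "b > 0"
  shows "(\<Sum>\<eta>\<in>lazy_steps n. lazy_weight \<mu> n \<eta> * exp (- b * (cmod (to_cplx (walk_end n v \<eta>)))\<^sup>2))
    \<le> (2 / (1 - exp (- b)))\<^sup>2 * ((\<Sum>w\<in>grid p. exp (- \<mu> * energy p v S w)) / p\<^sup>2)"
proof -
  define Q where "Q = (\<Sum>w\<in>grid p. exp (- \<mu> * energy p v S w)) / p\<^sup>2"
  define H where "H = walk_end n v ` lazy_steps n"
  define f where "f h = exp (- b * ((real_of_int (fst h))\<^sup>2 + (real_of_int (snd h))\<^sup>2))" for h
  have Q0: "Q \<ge> 0" unfolding Q_def by (intro divide_nonneg_nonneg sum_nonneg) auto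
  have "(\<Sum>\<eta>\<in>lazy_steps n. lazy_weight \<mu> n \<eta> * exp (- b * (cmod (to_cplx (walk_end n v \<eta>)))\<^sup>2))
     = (\<Sum>\<eta>\<in>lazy_steps n. lazy_weight \<mu> n \<eta> * f (walk_end n v \<eta>))"
    by (simp add: f_def to_cplx_def cmod_power2)
  also have "\<dots> = (\<Sum>h\<in>H. \<Sum>\<eta> | \<eta> \<in> lazy_steps n \<and> walk_end n v \<eta> = h. lazy_weight \<mu> n \<eta> * f (walk_end n v \<eta>))"
    by (rule sum.group[symmetric]) (auto simp: H_def)
  also have "\<dots> = (\<Sum>h\<in>H. (\<Sum>\<eta> | \<eta> \<in> lazy_steps n \<and> walk_end n v \<eta> = h. lazy_weight \<mu> n \<eta>) * f h)"
    by (simp add: sum_distrib_right)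
  also have "\<dots> \<le> (\<Sum>h\<in>H. Q * f h)"
    unfolding Q_def using p \<mu> S by (intro sum_mono mult_right_mono walk_point_mass_le) (auto simp: f_def)
  also have "\<dots> = Q * (\<Sum>h\<in>H. f h)" by (simp add: sum_distrib_left)
  also have "\<dots> \<le> Q * (2 / (1 - exp (- b)))\<^sup>2"
    unfolding f_def using Q0 b by (intro mult_left_mono sum_gaussian_lattice_le) (auto simp: H_def)
  finally show ?thesis by (simp add: Q_def mult_ac)
qed

section \<open>From small balls to lazy walks\<close>

definition plane_gaussian :: "(real \<times> real) measure" where
  "plane_gaussian = std_normal_distribution \<Otimes>\<^sub>M std_normal_distribution"

text \<open>The real inner product of the plane, linear in each argument.\<close>

definition pairing :: "complex \<Rightarrow> real \<times> real \<Rightarrow> real" where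
  "pairing z Z = Re z * fst Z + Im z * snd Z"

lemma cis_measurable [measurable]: "cis \<in> borel_measurable borel"
  by (intro borel_measurable_continuous_onI continuous_intros)

lemma sets_plane_gaussian [measurable_cong]: "sets plane_gaussian = sets borel"
  unfolding plane_gaussian_def borel_prod[symmetric] by (intro sets_pair_measure_cong) simp_all

lemma prob_space_std_normal: "prob_space std_normal_distribution"
  using real_dist_normal_dist by (simp add: real_distribution_def)

lemma prob_space_plane_gaussian: "prob_space plane_gaussian"
  unfolding plane_gaussian_def by (intro prob_space_pair prob_space_std_normal)

lemma pairing_measurable [measurable]:
  assumes [measurable]: "f \<in> borel_measurable N" "g \<in> measurable N borel"
  shows "(\<lambda>x. pairing (f x) (g x)) \<in> borel_measurable N"
proof -
  have [measurable]: "g \<in> N \<rightarrow>\<^sub>M (borel \<Otimes>\<^sub>M borel)" unfolding borel_prod by measurable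
  show ?thesis unfolding pairing_def by measurable
qed

lemma prob_Fubini:
  fixes f :: "'a \<Rightarrow> 'b \<Rightarrow> 'c::{banach, second_countable_topology}"
  assumes "prob_space M1" "prob_space M2"
    and [measurable]: "case_prod f \<in> borel_measurable (M1 \<Otimes>\<^sub>M M2)" and b: "\<And>x y. norm (f x y) \<le> B"
  shows "(\<integral>x. (\<integral>y. f x y \<partial>M2) \<partial>M1) = (\<integral>y. (\<integral>x. f x y \<partial>M1) \<partial>M2)"
    and "(\<integral>z. f (fst z) (snd z) \<partial>(M1 \<Otimes>\<^sub>M M2)) = (\<integral>x. (\<integral>y. f x y \<partial>M2) \<partial>M1)"
proof -
  interpret M1: prob_space M1 by fact
  interpret M2: prob_space M2 by fact
  interpret P: pair_prob_space M1 M2 ..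
  have int: "integrable (M1 \<Otimes>\<^sub>M M2) (case_prod f)"
    by (rule P.integrable_const_bound[where B = B]) (auto simp: b)
  show "(\<integral>x. (\<integral>y. f x y \<partial>M2) \<partial>M1) = (\<integral>y. (\<integral>x. f x y \<partial>M1) \<partial>M2)"
    by (rule P.Fubini_integral[OF int, symmetric])
  show "(\<integral>z. f (fst z) (snd z) \<partial>(M1 \<Otimes>\<^sub>M M2)) = (\<integral>x. (\<integral>y. f x y \<partial>M2) \<partial>M1)"
    using P.integral_fst'[OF int] by (simp add: case_prod_beta')
qed

lemma integral_cis_plane_gaussian:
  "(\<integral>Z. cis (pairing z Z) \<partial>plane_gaussian) = complex_of_real (exp (- (cmod z)\<^sup>2 / 2))"
proof -
  have ch: "(\<integral>x. cis (t * x) \<partial>std_normal_distribution) = complex_of_real (exp (- t\<^sup>2 / 2))" for t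
    using fun_cong[OF char_std_normal_distribution, of t] by (simp add: char_def cis_conv_exp)
  have "(\<integral>Z. cis (pairing z Z) \<partial>plane_gaussian)
      = (\<integral>Z. cis (Re z * fst Z) * cis (Im z * snd Z) \<partial>(std_normal_distribution \<Otimes>\<^sub>M std_normal_distribution))"
    by (simp add: plane_gaussian_def pairing_def cis_mult)
  also have "\<dots> = (\<integral>x. (\<integral>y. cis (Re z * x) * cis (Im z * y) \<partial>std_normal_distribution) \<partial>std_normal_distribution)"
    by (rule prob_Fubini(2)[where B = 1]) (auto simp: prob_space_std_normal norm_mult case_prod_beta')
  also have "\<dots> = complex_of_real (exp (- (Re z)\<^sup>2 / 2)) * complex_of_real (exp (- (Im z)\<^sup>2 / 2))"
    by (simp add: ch)
  also have "\<dots> = complex_of_real (exp (- (cmod z)\<^sup>2 / 2))"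
    by (simp add: cmod_power2 add_divide_distrib diff_divide_distrib flip: exp_add of_real_mult)
  finally show ?thesis .
qed

lemma pairing_diff: "pairing (a - b) Z = pairing a Z - pairing b Z"
  by (simp add: pairing_def algebra_simps)

lemma pairing_sum: "pairing (\<Sum>j\<in>J. f j) Z = (\<Sum>j\<in>J. pairing (f j) Z)"
  by (simp add: pairing_def sum_distrib_right sum.distrib)

definition char_fun :: "complex measure \<Rightarrow> complex \<Rightarrow> real \<times> real \<Rightarrow> complex" where
  "char_fun M c Z = (\<integral>\<xi>. cis (pairing (c * \<xi>) Z) \<partial>M)"

lemma norm_char_fun_le:
  assumes M: "prob_space M" "sets M = sets borel"
  shows "cmod (char_fun M c Z) \<le> 1"
proof -
  interpret prob_space M by fact
  have "cmod (char_fun M c Z) \<le> (\<integral>\<xi>. cmod (cis (pairing (c * \<xi>) Z)) \<partial>M)"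
    unfolding char_fun_def by (rule integral_norm_bound)
  then show ?thesis by (simp add: prob_space)
qed

text \<open>Symmetrisation: the squared modulus is the characteristic function of the difference of
  two independent copies. It is real, so only the cosine remains.\<close>

lemma norm_char_fun_sq:
  assumes M: "prob_space M" and [measurable_cong]: "sets M = sets borel"
  shows "(cmod (char_fun M c Z))\<^sup>2 = 1 - (\<integral>z. 1 - cos (pairing (c * (fst z - snd z)) Z) \<partial>(M \<Otimes>\<^sub>M M))"
proof -
  interpret M: prob_space M by fact
  interpret P: pair_prob_space M M ..
  have [measurable]: "(\<lambda>\<xi>. pairing (c * \<xi>) Z) \<in> borel_measurable M" by measurable
  have "complex_of_real ((cmod (char_fun M c Z))\<^sup>2) = char_fun M c Z * cnj (char_fun M c Z)"
    by (rule complex_norm_square)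
  also have "\<dots> = (\<integral>a. (\<integral>b. cis (pairing (c * a) Z) * cnj (cis (pairing (c * b) Z)) \<partial>M) \<partial>M)"
    by (simp add: char_fun_def)
  also have "\<dots> = (\<integral>z. cis (pairing (c * fst z) Z) * cnj (cis (pairing (c * snd z) Z)) \<partial>(M \<Otimes>\<^sub>M M))"
    by (rule prob_Fubini(2)[where B = 1, symmetric]) (auto simp: M norm_mult case_prod_beta' cis_cnj)
  also have "\<dots> = (\<integral>z. cis (pairing (c * (fst z - snd z)) Z) \<partial>(M \<Otimes>\<^sub>M M))"
    by (simp add: cis_cnj cis_mult pairing_diff right_diff_distrib)
  finally have "(cmod (char_fun M c Z))\<^sup>2 = Re (\<integral>z. cis (pairing (c * (fst z - snd z)) Z) \<partial>(M \<Otimes>\<^sub>M M))"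
    by (metis Re_complex_of_real)
  also have "\<dots> = (\<integral>z. cos (pairing (c * (fst z - snd z)) Z) \<partial>(M \<Otimes>\<^sub>M M))"
    by (subst integral_Re[symmetric]) (auto intro!: P.integrable_const_bound[where B = 1])
  also have "\<dots> = 1 - (\<integral>z. 1 - cos (pairing (c * (fst z - snd z)) Z) \<partial>(M \<Otimes>\<^sub>M M))"
    by (subst Bochner_Integration.integral_diff) (auto intro!: P.integrable_const_bound[where B = 1] simp: P.prob_space)
  finally show ?thesis .
qed

lemma le_exp_half_sq:
  fixes t :: real
  shows "t \<le> exp (- (1 - t\<^sup>2) / 2)"
proof (rule power2_le_imp_le)
  have "t\<^sup>2 \<le> exp (t\<^sup>2 - 1)" using exp_ge_add_one_self[of "t\<^sup>2 - 1"] by simp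
  also have "\<dots> = (exp (- (1 - t\<^sup>2) / 2))\<^sup>2" by (simp flip: exp_double)
  finally show "t\<^sup>2 \<le> (exp (- (1 - t\<^sup>2) / 2))\<^sup>2" .
qed simp

text \<open>Jensen's inequality for the conditional law given \<open>A\<close>, via the tangent line of the exponential.\<close>

lemma (in prob_space) exp_expectation_le_on_event:
  fixes Y :: "'a \<Rightarrow> real"
  assumes Ym [measurable]: "Y \<in> borel_measurable M" and Y: "\<And>x. 0 \<le> Y x" "\<And>x. Y x \<le> B"
    and A [measurable]: "A \<in> events" and C: "C \<ge> 1" "prob A \<ge> 1 / C"
  shows "exp (- expectation Y / 2) \<le> C * expectation (\<lambda>x. indicator A x * exp (- Y x / (2 * C)))"
proof -
  define a where "a = prob A"
  define E where "E = expectation (\<lambda>x. indicator A x * Y x)"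
  define m where "m = E / a"
  define c where "c = 1 / (2 * C)"
  have a: "a > 0" "a \<ge> 1 / C" using C by (auto simp: a_def intro: less_le_trans[of _ "1 / C"])
  have c0: "c > 0" using C by (simp add: c_def)
  have B: "B \<ge> 0" using Y order_trans by blast
  have iY: "integrable M (\<lambda>x. indicator A x * Y x)"
    using Y B by (intro integrable_const_bound[where B = B]) (auto simp: indicator_def)
  have iY': "integrable M Y"
    using Y by (intro integrable_const_bound[where B = B]) auto
  have iA: "integrable M (\<lambda>x. indicator A x :: real)"
    by (intro integrable_const_bound[where B = 1]) auto
  have E0: "0 \<le> E" unfolding E_def using Y by (intro integral_nonneg_AE) auto
  have EY: "E \<le> expectation Y"
    unfolding E_def using Y by (intro integral_mono iY iY') (auto simp: indicator_def)
  \<comment> \<open>The tangent line is taken at \<open>m\<close>, the conditional mean of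
    \<open>Y\<close> given \<open>A\<close>, so that its first-order term integrates to zero over
    \<open>A\<close>.\<close>
  have pw: "exp (- c * m) * (1 + c * m) * indicator A x - exp (- c * m) * c * (indicator A x * Y x)
      \<le> indicator A x * exp (- c * Y x)" for x
  proof -
    have "exp (- c * m) * (1 + (- c * Y x + c * m)) \<le> exp (- c * m) * exp (- c * Y x + c * m)"
      by (intro mult_left_mono exp_ge_add_one_self) auto
    also have "\<dots> = exp (- c * Y x)" by (simp flip: exp_add)
    finally show ?thesis by (auto simp: indicator_def algebra_simps)
  qed
  have "exp (- c * m) * a = exp (- c * m) * (1 + c * m) * a - exp (- c * m) * c * E"
    using a by (simp add: m_def field_simps)
  also have "\<dots> = expectation (\<lambda>x. exp (- c * m) * (1 + c * m) * indicator A x - exp (- c * m) * c * (indicator A x * Y x))"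
    using iY iA by (simp add: a_def E_def)
  also have "\<dots> \<le> expectation (\<lambda>x. indicator A x * exp (- c * Y x))"
  proof (rule integral_mono[OF _ _ pw])
    show "integrable M (\<lambda>x. exp (- c * m) * (1 + c * m) * indicator A x - exp (- c * m) * c * (indicator A x * Y x))"
      using iY iA by (intro Bochner_Integration.integrable_diff integrable_mult_right)
    show "integrable M (\<lambda>x. indicator A x * exp (- c * Y x))"
      using c0 Y by (intro integrable_const_bound[where B = 1]) (auto simp: indicator_def)
  qed
  finally have J: "exp (- c * m) * a \<le> expectation (\<lambda>x. indicator A x * exp (- c * Y x))" .
  \<comment> \<open>\<open>m = E / a\<close> and \<open>c = 1 / (2 * C) \<le> a / 2\<close>, so the
    division by \<open>prob A\<close> cancels; the remaining factor \<open>a\<close> is paid for by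
    the \<open>C\<close> in front.\<close>
  have "c * m \<le> expectation Y / 2"
  proof -
    have "c \<le> a / 2" using a C by (simp add: c_def field_simps)
    then have "c * m \<le> (a / 2) * m" using E0 a by (intro mult_right_mono) (auto simp: m_def)
    also have "\<dots> = E / 2" using a by (simp add: m_def)
    finally show ?thesis using EY by simp
  qed
  then have "exp (- expectation Y / 2) \<le> exp (- c * m) * 1" by simp
  also have "\<dots> \<le> exp (- c * m) * (C * a)"
    using a C by (intro mult_left_mono) (auto simp: field_simps)
  also have "\<dots> \<le> C * expectation (\<lambda>x. indicator A x * exp (- c * Y x))"
    using J C mult_left_mono[OF J, of C] by (simp add: mult_ac)
  finally show ?thesis by (simp add: c_def)
qed

lemma char_fun_measurable [measurable]:
  assumes M: "prob_space M" and [measurable_cong]: "sets M = sets borel"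
  shows "char_fun M c \<in> borel_measurable borel"
proof -
  interpret prob_space M by fact
  have "(\<lambda>Z. \<integral>\<xi>. cis (pairing (c * \<xi>) Z) \<partial>M) \<in> borel_measurable borel" by measurable
  then show ?thesis by (simp add: char_fun_def[abs_def])
qed

text \<open>On the unit disc \<open>exp (1/2) * exp (- \<bar>S\<bar>\<^sup>2 / 2)\<close> is at
  least 1. Writing the Gaussian as a mean of \<open>cis\<close> over a normal \<open>Z\<close> lets
  independence factor the expectation; the centre \<open>x\<close> contributes only a phase and
  disappears in the modulus.\<close>

lemma small_ball_le_integral_char_fun:
  fixes n :: nat and c :: "nat \<Rightarrow> complex"
  assumes M: "prob_space M" and sets_M [measurable_cong]: "sets M = sets borel"
  shows "measure (PiM {..<n} (\<lambda>_. M)) {w \<in> space (PiM {..<n} (\<lambda>_. M)). (\<Sum>i<n. c i * w i) \<in> cball x 1}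
    \<le> exp (1/2) * (\<integral>Z. (\<Prod>j<n. cmod (char_fun M (c j) Z)) \<partial>plane_gaussian)"
proof -
  interpret M: prob_space M by fact
  interpret PM: product_prob_space "\<lambda>_::nat. M" "{..<n}" by unfold_locales
  define P where "P = PiM {..<n} (\<lambda>_. M)"
  interpret P: prob_space P unfolding P_def by (rule prob_space_PiM) (rule M)
  interpret G: prob_space plane_gaussian by (rule prob_space_plane_gaussian)
  define S where "S w = (\<Sum>i<n. c i * w i) - x" for w
  have S_meas [measurable]: "S \<in> borel_measurable P" unfolding S_def P_def by measurable
  have ball: "{w \<in> space P. (\<Sum>i<n. c i * w i) \<in> cball x 1} = {w \<in> space P. cmod (S w) \<le> 1}"
    by (auto simp: S_def dist_norm norm_minus_commute)
  have ball_set [measurable]: "{w \<in> space P. cmod (S w) \<le> 1} \<in> sets P" by measurable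
  have "measure P {w \<in> space P. cmod (S w) \<le> 1} = (\<integral>w. indicator {w \<in> space P. cmod (S w) \<le> 1} w \<partial>P)"
    by simp
  also have "\<dots> \<le> (\<integral>w. exp (1/2) * exp (- (cmod (S w))\<^sup>2 / 2) \<partial>P)"
  proof (rule integral_mono)
    show "integrable P (\<lambda>w. indicator {w \<in> space P. cmod (S w) \<le> 1} w :: real)"
      by (intro P.integrable_const_bound[where B = 1]) auto
    show "integrable P (\<lambda>w. exp (1/2) * exp (- (cmod (S w))\<^sup>2 / 2))"
      by (intro integrable_mult_right P.integrable_const_bound[where B = 1]) auto
    fix w
    show "indicator {w \<in> space P. cmod (S w) \<le> 1} w \<le> exp (1/2) * exp (- (cmod (S w))\<^sup>2 / 2)"
    proof (cases "cmod (S w) \<le> 1")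
      case True
      then have "(cmod (S w))\<^sup>2 \<le> 1" by (simp add: power_le_one)
      then have "1 \<le> exp (1/2 + - (cmod (S w))\<^sup>2 / 2)" by simp
      then show ?thesis unfolding exp_add by (auto simp: indicator_def)
    qed auto
  qed
  also have "\<dots> = exp (1/2) * (\<integral>w. exp (- (cmod (S w))\<^sup>2 / 2) \<partial>P)" by simp
  also have "(\<integral>w. exp (- (cmod (S w))\<^sup>2 / 2) \<partial>P) \<le> (\<integral>Z. (\<Prod>j<n. cmod (char_fun M (c j) Z)) \<partial>plane_gaussian)"
  proof -
    have inner: "(\<integral>w. cis (pairing (S w) Z) \<partial>P) = cis (- pairing x Z) * (\<Prod>j<n. char_fun M (c j) Z)" for Z
    proof -
      have "cis (pairing (S w) Z) = cis (- pairing x Z) * (\<Prod>j<n. cis (pairing (c j * w j) Z))" for w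
      proof -
        show ?thesis
          unfolding cis_sum[symmetric] cis_mult by (simp add: S_def pairing_diff pairing_sum)
      qed
      then have "(\<integral>w. cis (pairing (S w) Z) \<partial>P) = cis (- pairing x Z) * (\<integral>w. (\<Prod>j<n. cis (pairing (c j * w j) Z)) \<partial>P)"
        by simp
      also have "(\<integral>w. (\<Prod>j<n. cis (pairing (c j * w j) Z)) \<partial>P) = (\<Prod>j<n. char_fun M (c j) Z)"
        unfolding P_def char_fun_def
        by (rule PM.product_integral_prod) (auto intro!: M.integrable_const_bound[where B = 1])
      finally show ?thesis .
    qed
    have "complex_of_real (\<integral>w. exp (- (cmod (S w))\<^sup>2 / 2) \<partial>P) = (\<integral>w. (\<integral>Z. cis (pairing (S w) Z) \<partial>plane_gaussian) \<partial>P)"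
      by (simp add: integral_cis_plane_gaussian)
    also have "\<dots> = (\<integral>Z. (\<integral>w. cis (pairing (S w) Z) \<partial>P) \<partial>plane_gaussian)"
      by (rule prob_Fubini(1)[where B = 1]) (auto simp: P.prob_space_axioms prob_space_plane_gaussian case_prod_beta')
    also have "\<dots> = (\<integral>Z. cis (- pairing x Z) * (\<Prod>j<n. char_fun M (c j) Z) \<partial>plane_gaussian)"
      by (simp only: inner)
    finally have eq: "complex_of_real (\<integral>w. exp (- (cmod (S w))\<^sup>2 / 2) \<partial>P)
        = (\<integral>Z. cis (- pairing x Z) * (\<Prod>j<n. char_fun M (c j) Z) \<partial>plane_gaussian)" .
    have "(\<integral>w. exp (- (cmod (S w))\<^sup>2 / 2) \<partial>P) = cmod (complex_of_real (\<integral>w. exp (- (cmod (S w))\<^sup>2 / 2) \<partial>P))"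
      by (simp add: integral_nonneg_AE)
    also have "\<dots> \<le> (\<integral>Z. cmod (cis (- pairing x Z) * (\<Prod>j<n. char_fun M (c j) Z)) \<partial>plane_gaussian)"
      unfolding eq by (rule integral_norm_bound)
    also have "\<dots> = (\<integral>Z. (\<Prod>j<n. cmod (char_fun M (c j) Z)) \<partial>plane_gaussian)"
      by (simp add: norm_mult prod_norm)
    finally show ?thesis .
  qed
  finally show ?thesis unfolding P_def[symmetric] ball by simp
qed

text \<open>The product of moduli is at most \<open>exp (- E Y / 2)\<close> with \<open>Y\<close>
  the total \<open>1 - cos\<close> of the symmetrised variables. Jensen's inequality on the annulus
  replaces the mean over differences in the exponent by a mean of exponentials, and Fubini then
  reduces to one fixed difference \<open>y\<close>.\<close>

lemma integral_char_fun_le: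
  fixes n :: nat and c :: "nat \<Rightarrow> complex"
  assumes M: "prob_space M" and sets_M [measurable_cong]: "sets M = sets borel" and good: "good C M"
    and B: "\<And>y. 1 / C \<le> cmod y \<Longrightarrow>
      (\<integral>Z. exp (- (\<Sum>j<n. 1 - cos (pairing (c j * y) Z)) / (2 * C)) \<partial>plane_gaussian) \<le> B"
  shows "(\<integral>Z. (\<Prod>j<n. cmod (char_fun M (c j) Z)) \<partial>plane_gaussian) \<le> C * B"
proof -
  interpret M: prob_space M by fact
  interpret MM: pair_prob_space M M ..
  interpret G: prob_space plane_gaussian by (rule prob_space_plane_gaussian)
  have C: "C \<ge> 1" using good by (simp add: good_def)
  define A where "A = {z. 1 / C \<le> cmod (fst z - snd z) \<and> cmod (fst z - snd z) \<le> C}"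
  have sp: "space M = UNIV" using sets_eq_imp_space_eq[OF sets_M] by simp
  have "{z \<in> space (M \<Otimes>\<^sub>M M). 1 / C \<le> cmod (fst z - snd z) \<and> cmod (fst z - snd z) \<le> C} \<in> sets (M \<Otimes>\<^sub>M M)"
    by measurable
  then have A [measurable]: "A \<in> sets (M \<Otimes>\<^sub>M M)" by (simp add: A_def space_pair_measure sp)
  have PA: "MM.prob A \<ge> 1 / C" using good by (simp add: good_def A_def)
  define Y where "Y z Z = (\<Sum>j<n. 1 - cos (pairing (c j * (fst z - snd z)) Z))" for z Z
  have Y_meas [measurable]: "(\<lambda>q. Y (fst q) (snd q)) \<in> borel_measurable ((M \<Otimes>\<^sub>M M) \<Otimes>\<^sub>M plane_gaussian)"
    unfolding Y_def by measurable
  have Y_meas1: "(\<lambda>z. Y z Z) \<in> borel_measurable (M \<Otimes>\<^sub>M M)" for Z unfolding Y_def by measurable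
  have Y0: "0 \<le> Y z Z" for z Z unfolding Y_def by (intro sum_nonneg) auto
  have Y1: "Y z Z \<le> 2 * n" for z Z
  proof -
    have "1 - cos t \<le> 2" for t :: real using cos_ge_minus_one[of t] by linarith
    then have "Y z Z \<le> (\<Sum>j<n. 2)" unfolding Y_def by (intro sum_mono)
    then show ?thesis by simp
  qed
  have bound: "norm (indicator A z * exp (- Y z Z / (2 * C))) \<le> 1" for z Z
    using Y0[of z Z] C by (auto simp: indicator_def)
  have pw: "(\<Prod>j<n. cmod (char_fun M (c j) Z)) \<le> C * (\<integral>z. indicator A z * exp (- Y z Z / (2 * C)) \<partial>(M \<Otimes>\<^sub>M M))" for Z
  proof -
    have "(\<Prod>j<n. cmod (char_fun M (c j) Z))
        \<le> (\<Prod>j<n. exp (- (\<integral>z. 1 - cos (pairing (c j * (fst z - snd z)) Z) \<partial>(M \<Otimes>\<^sub>M M)) / 2))"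
    proof (rule prod_mono, intro conjI)
      fix j
      show "cmod (char_fun M (c j) Z) \<le> exp (- (\<integral>z. 1 - cos (pairing (c j * (fst z - snd z)) Z) \<partial>(M \<Otimes>\<^sub>M M)) / 2)"
        using le_exp_half_sq[of "cmod (char_fun M (c j) Z)"] unfolding norm_char_fun_sq[OF M sets_M] by simp
    qed simp
    also have "\<dots> = exp (\<Sum>j<n. - (\<integral>z. 1 - cos (pairing (c j * (fst z - snd z)) Z) \<partial>(M \<Otimes>\<^sub>M M)) / 2)"
      by (simp add: exp_sum)
    also have "(\<Sum>j<n. - (\<integral>z. 1 - cos (pairing (c j * (fst z - snd z)) Z) \<partial>(M \<Otimes>\<^sub>M M)) / 2)
        = - (\<integral>z. Y z Z \<partial>(M \<Otimes>\<^sub>M M)) / 2"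
    proof -
      have "(\<integral>z. Y z Z \<partial>(M \<Otimes>\<^sub>M M)) = (\<Sum>j<n. \<integral>z. 1 - cos (pairing (c j * (fst z - snd z)) Z) \<partial>(M \<Otimes>\<^sub>M M))"
        unfolding Y_def
      proof (rule Bochner_Integration.integral_sum)
        fix j
        have "\<bar>1 - cos t\<bar> \<le> 2" for t :: real using cos_ge_minus_one[of t] cos_le_one[of t] by linarith
        then show "integrable (M \<Otimes>\<^sub>M M) (\<lambda>z. 1 - cos (pairing (c j * (fst z - snd z)) Z))"
          by (intro MM.integrable_const_bound[where B = 2]) auto
      qed
      then show ?thesis by (simp add: sum_negf sum_divide_distrib)
    qed
    also have "exp (- (\<integral>z. Y z Z \<partial>(M \<Otimes>\<^sub>M M)) / 2) \<le> C * (\<integral>z. indicator A z * exp (- Y z Z / (2 * C)) \<partial>(M \<Otimes>\<^sub>M M))"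
      by (rule MM.exp_expectation_le_on_event[OF Y_meas1 Y0 Y1 A C PA])
    finally show ?thesis .
  qed
  have m1: "(\<lambda>q. indicator A (fst q) * exp (- Y (fst q) (snd q) / (2 * C))) \<in> borel_measurable ((M \<Otimes>\<^sub>M M) \<Otimes>\<^sub>M plane_gaussian)"
    by measurable
  have m2: "(\<lambda>q. indicator A (snd q) * exp (- Y (snd q) (fst q) / (2 * C))) \<in> borel_measurable (plane_gaussian \<Otimes>\<^sub>M (M \<Otimes>\<^sub>M M))"
    using measurable_compose[OF measurable_pair_swap' m1] by (simp add: case_prod_beta')
  have "(\<integral>Z. (\<Prod>j<n. cmod (char_fun M (c j) Z)) \<partial>plane_gaussian)
      \<le> (\<integral>Z. C * (\<integral>z. indicator A z * exp (- Y z Z / (2 * C)) \<partial>(M \<Otimes>\<^sub>M M)) \<partial>plane_gaussian)"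
  proof (rule integral_mono[OF _ _ pw])
    have [measurable]: "char_fun M (c j) \<in> borel_measurable plane_gaussian" for j
      using char_fun_measurable[OF M sets_M] measurable_cong_sets[OF sets_plane_gaussian refl] by blast
    show "integrable plane_gaussian (\<lambda>Z. \<Prod>j<n. cmod (char_fun M (c j) Z))"
      using norm_char_fun_le[OF M sets_M]
      by (intro G.integrable_const_bound[where B = 1]) (auto simp: abs_prod intro!: prod_le_1)
    have "(\<lambda>Z. \<integral>z. indicator A z * exp (- Y z Z / (2 * C)) \<partial>(M \<Otimes>\<^sub>M M)) \<in> borel_measurable plane_gaussian"
      using m2 by (intro MM.borel_measurable_lebesgue_integral) (simp add: case_prod_beta')
    moreover have "norm (\<integral>z. indicator A z * exp (- Y z Z / (2 * C)) \<partial>(M \<Otimes>\<^sub>M M)) \<le> 1" for Z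
    proof -
      have "norm (\<integral>z. indicator A z * exp (- Y z Z / (2 * C)) \<partial>(M \<Otimes>\<^sub>M M))
          \<le> (\<integral>z. norm (indicator A z * exp (- Y z Z / (2 * C))) \<partial>(M \<Otimes>\<^sub>M M))"
        by (rule integral_norm_bound)
      also have "\<dots> \<le> (\<integral>z. 1 \<partial>(M \<Otimes>\<^sub>M M))"
        by (rule integral_mono') (use bound in auto)
      finally show ?thesis by (simp add: MM.prob_space)
    qed
    ultimately show "integrable plane_gaussian (\<lambda>Z. C * (\<integral>z. indicator A z * exp (- Y z Z / (2 * C)) \<partial>(M \<Otimes>\<^sub>M M)))"
      by (intro integrable_mult_right G.integrable_const_bound[where B = 1]) auto
  qed
  also have "\<dots> = C * (\<integral>Z. (\<integral>z. indicator A z * exp (- Y z Z / (2 * C)) \<partial>(M \<Otimes>\<^sub>M M)) \<partial>plane_gaussian)" by simp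
  also have "(\<integral>Z. (\<integral>z. indicator A z * exp (- Y z Z / (2 * C)) \<partial>(M \<Otimes>\<^sub>M M)) \<partial>plane_gaussian)
      = (\<integral>z. (\<integral>Z. indicator A z * exp (- Y z Z / (2 * C)) \<partial>plane_gaussian) \<partial>(M \<Otimes>\<^sub>M M))"
    by (rule prob_Fubini(1)[OF G.prob_space_axioms MM.prob_space_axioms _ bound]) (use m2 in \<open>simp add: case_prod_beta'\<close>)
  also have "C * \<dots> \<le> C * (\<integral>z. B \<partial>(M \<Otimes>\<^sub>M M))"
  proof (rule mult_left_mono)
    \<comment> \<open>Nonnegativity of \<open>B\<close> is read off from the admissible value
      \<open>y = 1\<close>.\<close>
    have "0 \<le> (\<integral>Z. exp (- (\<Sum>j<n. 1 - cos (pairing (c j * 1) Z)) / (2 * C)) \<partial>plane_gaussian)"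
      by (intro integral_nonneg_AE) auto
    also have "\<dots> \<le> B" using C by (intro B) auto
    finally have B0: "B \<ge> 0" .
    show "(\<integral>z. (\<integral>Z. indicator A z * exp (- Y z Z / (2 * C)) \<partial>plane_gaussian) \<partial>(M \<Otimes>\<^sub>M M)) \<le> (\<integral>z. B \<partial>(M \<Otimes>\<^sub>M M))"
    proof (rule integral_mono')
      fix z
      show "(\<integral>Z. indicator A z * exp (- Y z Z / (2 * C)) \<partial>plane_gaussian) \<le> B"
        using B[of "fst z - snd z"] B0 by (cases "z \<in> A") (auto simp: A_def Y_def)
    qed (use B0 in auto)
  qed (use C in auto)
  also have "\<dots> = C * B" by (simp add: MM.prob_space)
  finally show ?thesis .
qed

text \<open>Convexity: the exponential lies below its chord over the range \<open>[0, 2]\<close> of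
  \<open>1 - cos\<close>.\<close>

lemma exp_le_linear_on_0_2:
  fixes c t :: real
  assumes "0 \<le> t" "t \<le> 2"
  shows "exp (- c * t) \<le> 1 - (1 - exp (- 2 * c)) / 2 * t"
proof -
  have "exp ((1 - t / 2) *\<^sub>R 0 + (t / 2) *\<^sub>R (- 2 * c)) \<le> (1 - t / 2) * exp 0 + (t / 2) * exp (- 2 * c)"
    using assms by (intro convex_onD[OF exp_convex]) auto
  then show ?thesis by (simp add: field_simps)
qed

text \<open>The chord bound turns each factor into a lazy characteristic function. After expansion
  the Gaussian integral sees \<open>y\<close> only through \<open>cmod (h * y)\<close> for a lattice
  endpoint \<open>h\<close>, and \<open>cmod y \<ge> 1 / C\<close> removes it altogether.\<close>

lemma integral_exp_cos_le:
  assumes C: "C \<ge> 1" and y: "1 / C \<le> cmod y"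
  defines "\<mu> \<equiv> (1 - exp (- 1 / C)) / 2"
  shows "(\<integral>Z. exp (- (\<Sum>j<n. 1 - cos (pairing (to_cplx (v j) * y) Z)) / (2 * C)) \<partial>plane_gaussian)
    \<le> (\<Sum>\<eta>\<in>lazy_steps n. lazy_weight \<mu> n \<eta> * exp (- (1 / (2 * C\<^sup>2)) * (cmod (to_cplx (walk_end n v \<eta>)))\<^sup>2))"
proof -
  interpret G: prob_space plane_gaussian by (rule prob_space_plane_gaussian)
  have \<mu>: "0 \<le> \<mu>" "\<mu> \<le> 1/2" using C by (auto simp: \<mu>_def)
  define \<theta> where "\<theta> Z j = pairing (to_cplx (v j) * y) Z" for Z j
  have \<theta>_meas [measurable]: "(\<lambda>Z. \<theta> Z j) \<in> borel_measurable plane_gaussian" for j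
    unfolding \<theta>_def by measurable
  have fac: "0 \<le> 1 - \<mu> * (1 - cos t)" "1 - \<mu> * (1 - cos t) \<le> 1"
    "exp (- (1 / (2 * C)) * (1 - cos t)) \<le> 1 - \<mu> * (1 - cos t)" for t
  proof -
    have t: "0 \<le> 1 - cos t" "1 - cos t \<le> 2" using cos_ge_minus_one[of t] cos_le_one[of t] by linarith+
    have "\<mu> * (1 - cos t) \<le> (1/2) * 2" using \<mu> t by (intro mult_mono) auto
    then show "0 \<le> 1 - \<mu> * (1 - cos t)" by simp
    show "1 - \<mu> * (1 - cos t) \<le> 1" using \<mu> by simp
    show "exp (- (1 / (2 * C)) * (1 - cos t)) \<le> 1 - \<mu> * (1 - cos t)"
      using exp_le_linear_on_0_2[OF t, of "1 / (2 * C)"] by (simp add: \<mu>_def)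
  qed
  have walk: "(\<Sum>j<n. of_int (\<eta> j) * \<theta> Z j) = pairing (to_cplx (walk_end n v \<eta>) * y) Z" for \<eta> Z
  proof -
    have "to_cplx (walk_end n v \<eta>) = (\<Sum>j<n. of_int (\<eta> j) * to_cplx (v j))"
      by (simp add: complex_eq_iff to_cplx_def walk_end_def)
    then have "pairing (to_cplx (walk_end n v \<eta>) * y) Z = (\<Sum>j<n. pairing (of_int (\<eta> j) * to_cplx (v j) * y) Z)"
      by (simp add: pairing_sum sum_distrib_right)
    also have "\<dots> = (\<Sum>j<n. of_int (\<eta> j) * \<theta> Z j)"
      by (intro sum.cong refl) (simp add: \<theta>_def pairing_def algebra_simps)
    finally show ?thesis by simp
  qed
  have "(\<integral>Z. exp (- (\<Sum>j<n. 1 - cos (\<theta> Z j)) / (2 * C)) \<partial>plane_gaussian) \<le> (\<integral>Z. (\<Prod>j<n. 1 - \<mu> * (1 - cos (\<theta> Z j))) \<partial>plane_gaussian)"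
  proof (rule integral_mono)
    show "integrable plane_gaussian (\<lambda>Z. exp (- (\<Sum>j<n. 1 - cos (\<theta> Z j)) / (2 * C)))"
      using C by (intro G.integrable_const_bound[where B = 1]) (auto intro!: sum_nonneg divide_nonneg_nonneg)
    show "integrable plane_gaussian (\<lambda>Z. \<Prod>j<n. 1 - \<mu> * (1 - cos (\<theta> Z j)))"
      using fac by (intro G.integrable_const_bound[where B = 1]) (auto simp: abs_prod intro!: prod_le_1)
    fix Z
    have "exp (- (\<Sum>j<n. 1 - cos (\<theta> Z j)) / (2 * C)) = exp (\<Sum>j<n. - (1 / (2 * C)) * (1 - cos (\<theta> Z j)))"
      unfolding sum_distrib_left[symmetric] by simp
    also have "\<dots> = (\<Prod>j<n. exp (- (1 / (2 * C)) * (1 - cos (\<theta> Z j))))" by (rule exp_sum) simp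
    also have "\<dots> \<le> (\<Prod>j<n. 1 - \<mu> * (1 - cos (\<theta> Z j)))" using fac by (intro prod_mono) auto
    finally show "exp (- (\<Sum>j<n. 1 - cos (\<theta> Z j)) / (2 * C)) \<le> (\<Prod>j<n. 1 - \<mu> * (1 - cos (\<theta> Z j)))" .
  qed
  also have "\<dots> = (\<Sum>\<eta>\<in>lazy_steps n. lazy_weight \<mu> n \<eta> * exp (- (cmod (to_cplx (walk_end n v \<eta>) * y))\<^sup>2 / 2))"
  proof -
    have "complex_of_real (\<integral>Z. (\<Prod>j<n. 1 - \<mu> * (1 - cos (\<theta> Z j))) \<partial>plane_gaussian)
        = (\<integral>Z. complex_of_real (\<Prod>j<n. 1 - \<mu> * (1 - cos (\<theta> Z j))) \<partial>plane_gaussian)"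
      by (rule integral_complex_of_real[symmetric])
    also have "\<dots> = (\<integral>Z. (\<Sum>\<eta>\<in>lazy_steps n. of_real (lazy_weight \<mu> n \<eta>) * cis (pairing (to_cplx (walk_end n v \<eta>) * y) Z)) \<partial>plane_gaussian)"
      by (simp only: prod_lazy_cos walk)
    also have "\<dots> = (\<Sum>\<eta>\<in>lazy_steps n. \<integral>Z. of_real (lazy_weight \<mu> n \<eta>) * cis (pairing (to_cplx (walk_end n v \<eta>) * y) Z) \<partial>plane_gaussian)"
      by (intro Bochner_Integration.integral_sum integrable_mult_right G.integrable_const_bound[where B = 1]) auto
    also have "\<dots> = complex_of_real (\<Sum>\<eta>\<in>lazy_steps n. lazy_weight \<mu> n \<eta> * exp (- (cmod (to_cplx (walk_end n v \<eta>) * y))\<^sup>2 / 2))"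
      by (simp add: integral_cis_plane_gaussian)
    finally show ?thesis by (simp only: of_real_eq_iff)
  qed
  also have "\<dots> \<le> (\<Sum>\<eta>\<in>lazy_steps n. lazy_weight \<mu> n \<eta> * exp (- (1 / (2 * C\<^sup>2)) * (cmod (to_cplx (walk_end n v \<eta>)))\<^sup>2))"
  proof (intro sum_mono mult_left_mono)
    fix \<eta>
    define V where "V = cmod (to_cplx (walk_end n v \<eta>))"
    have "(1 / C)\<^sup>2 \<le> (cmod y)\<^sup>2" using y C by (intro power_mono) auto
    then have "V\<^sup>2 * (1 / C)\<^sup>2 \<le> V\<^sup>2 * (cmod y)\<^sup>2" by (intro mult_left_mono) auto
    then show "exp (- (cmod (to_cplx (walk_end n v \<eta>) * y))\<^sup>2 / 2) \<le> exp (- (1 / (2 * C\<^sup>2)) * (cmod (to_cplx (walk_end n v \<eta>)))\<^sup>2)"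
      by (simp add: V_def norm_mult power_mult_distrib power_divide)
    show "0 \<le> lazy_weight \<mu> n \<eta>" using \<mu> by (intro lazy_weight_nonneg) auto
  qed
  finally show ?thesis by (simp add: \<theta>_def)
qed

text \<open>The right-hand side does not involve the centre of the disc, so it bounds the supremum.
  \<open>p\<close> and \<open>S\<close> are free, so one vector can be tested against every subset
  of its support.\<close>

lemma rho_conc_le:
  assumes M: "is_cplx_rv M" and good: "good C M" and p: "p > 0" and S: "S \<subseteq> {..<n}"
  defines "\<mu> \<equiv> (1 - exp (- 1 / C)) / 2"
  shows "rho_conc 1 M n v \<le> exp (1/2) * C * (2 / (1 - exp (- (1 / (2 * C\<^sup>2)))))\<^sup>2
     * ((\<Sum>w\<in>grid p. exp (- \<mu> * energy p v S w)) / p\<^sup>2)"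
  unfolding rho_conc_def
proof (rule cSUP_least)
  fix x :: complex
  have M': "prob_space M" "sets M = sets borel" using M by (auto simp: is_cplx_rv_def)
  have C: "C \<ge> 1" using good by (simp add: good_def)
  have \<mu>: "0 \<le> \<mu>" "\<mu> \<le> 1/2" using C by (auto simp: \<mu>_def)
  define B where "B = (2 / (1 - exp (- (1 / (2 * C\<^sup>2)))))\<^sup>2 * ((\<Sum>w\<in>grid p. exp (- \<mu> * energy p v S w)) / p\<^sup>2)"
  have "(\<integral>Z. exp (- (\<Sum>j<n. 1 - cos (pairing (to_cplx (v j) * y) Z)) / (2 * C)) \<partial>plane_gaussian) \<le> B"
    if y: "1 / C \<le> cmod y" for y
  proof -
    have "(\<integral>Z. exp (- (\<Sum>j<n. 1 - cos (pairing (to_cplx (v j) * y) Z)) / (2 * C)) \<partial>plane_gaussian)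
      \<le> (\<Sum>\<eta>\<in>lazy_steps n. lazy_weight \<mu> n \<eta> * exp (- (1 / (2 * C\<^sup>2)) * (cmod (to_cplx (walk_end n v \<eta>)))\<^sup>2))"
      unfolding \<mu>_def by (rule integral_exp_cos_le[OF C y])
    also have "\<dots> \<le> B" unfolding B_def using p \<mu> S C by (intro walk_gaussian_le) auto
    finally show ?thesis .
  qed
  then have "(\<integral>Z. (\<Prod>j<n. cmod (char_fun M (to_cplx (v j)) Z)) \<partial>plane_gaussian) \<le> C * B"
    by (rule integral_char_fun_le[OF M' good])
  then have "exp (1/2) * (\<integral>Z. (\<Prod>j<n. cmod (char_fun M (to_cplx (v j)) Z)) \<partial>plane_gaussian) \<le> exp (1/2) * (C * B)"
    by (rule mult_left_mono) simp
  with small_ball_le_integral_char_fun[OF M', of n "\<lambda>j. to_cplx (v j)" x]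
  show "measure (PiM {..<n} (\<lambda>_. M)) {w \<in> space (PiM {..<n} (\<lambda>_. M)). (\<Sum>i<n. to_cplx (v i) * w i) \<in> cball x 1}
    \<le> exp (1/2) * C * (2 / (1 - exp (- (1 / (2 * C\<^sup>2)))))\<^sup>2 * ((\<Sum>w\<in>grid p. exp (- \<mu> * energy p v S w)) / p\<^sup>2)"
    unfolding B_def by (simp only: mult.assoc)
qed simp

section \<open>The counting theorem\<close>

lemma power_self_le_fact_exp: "real d ^ d \<le> fact d * exp (real d)"
proof -
  have s: "(\<lambda>n. real d ^ n /\<^sub>R fact n) sums exp (real d)" by (rule exp_converges)
  have "(\<Sum>n\<in>{d}. real d ^ n /\<^sub>R fact n) \<le> (\<Sum>n. real d ^ n /\<^sub>R fact n)"
    using s by (intro sum_le_suminf) (auto simp: sums_iff)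
  then show ?thesis using s by (simp add: sums_iff field_simps)
qed

lemma binomial_le_exp_power: "real (m choose d) * real d ^ d \<le> real m ^ d * exp (real d)"
proof -
  have "real (m choose d) * real d ^ d \<le> real (m choose d) * (fact d * exp (real d))"
    by (intro mult_left_mono power_self_le_fact_exp) auto
  also have "\<dots> = real ((m choose d) * fact d) * exp (real d)" by simp
  also have "\<dots> \<le> real (m ^ d) * exp (real d)"
    using binomial_fact_pow[of m d] by (intro mult_right_mono) (auto simp only: of_nat_le_iff exp_ge_zero)
  finally show ?thesis by simp
qed

text \<open>With \<open>d\<close> about \<open>5 * k / 4\<close>, the proportion is at most
  \<open>exp d * (d / m) ^ (2 * k - d)\<close>. Here \<open>2 * k - d \<ge> 3 * k / 4\<close>, and
  \<open>d / m\<close> is at most \<open>5/4\<close> over \<open>sqrt s\<close>, giving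
  \<open>s\<close> to the power \<open>- 3 * k / 8\<close> times an exponential in \<open>k\<close>.
  A part \<open>- k / 8\<close> of the exponent absorbs that exponential and \<open>- k / 4\<close>
  is left.\<close>

lemma few_values_negligible:
  assumes k: "1000 \<le> k" and s: "k\<^sup>2 \<le> s" and m: "s \<le> m"
  shows "real (m choose (5 * k div 4)) * real (5 * k div 4) ^ (2 * k) \<le> real s powr (- real k / 4) * real m ^ (2 * k)"
proof -
  define d where "d = 5 * k div 4"
  have d: "real d \<le> 5 * real k / 4" "d \<le> 2 * k" "d > 0" using k by (auto simp: d_def)
  have k2: "(1000::nat)^2 \<le> k^2" using k by (intro power_mono) auto
  have s6: "10^6 \<le> real s"
    using of_nat_mono[OF order_trans[OF k2 s], where 'a = real] by simp
  define L where "L = ln (real s)"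
  have s0: "real s > 0" using s6 by simp
  have m0: "real m > 0" using s0 m by simp
  \<comment> \<open>\<open>3 ^ 12 = 531441\<close> is below the bound \<open>10 ^ 6\<close> for
    \<open>s\<close>.\<close>
  have "exp (12::real) = exp 1 ^ 12" by (simp flip: exp_of_nat_mult)
  also have "\<dots> \<le> 3 ^ 12" using exp_le by (intro power_mono) auto
  also have "\<dots> \<le> real s" using s6 by simp
  finally have L: "L \<ge> 12" using s0 by (simp add: L_def ln_ge_iff)
  have lnk: "ln (real k) \<le> L / 2"
  proof -
    have "ln (real k ^ 2) \<le> L" unfolding L_def using k s s0
      by (subst ln_le_cancel_iff) (auto simp flip: of_nat_power)
    then show ?thesis using k by (simp add: ln_realpow)
  qed
  have lnd: "ln (real d / real m) \<le> 1/4 - L / 2"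
  proof -
    have "real d / real m \<le> (5 / 4 * real k) / real s" using d m s0 by (intro frac_le) auto
    then have "ln (real d / real m) \<le> ln ((5 / 4 * real k) / real s)"
      using d m0 k s0 by (subst ln_le_cancel_iff) auto
    also have "\<dots> = ln (5 / 4) + ln (real k) - L" using k s0 by (simp add: ln_div ln_mult L_def)
    also have "ln (5 / 4 :: real) \<le> 1/4" using ln_add_one_self_le_self[of "1/4::real"] by simp
    finally show ?thesis using lnk by simp
  qed
  define N where "N = 2 * k - d"
  have N: "3 * real k / 4 \<le> real N" using d by (simp add: N_def of_nat_diff)
  have "(real d / real m) ^ N = exp (real N * ln (real d / real m))"
    using d m0 by (simp add: exp_of_nat_mult)
  also have "\<dots> \<le> exp ((3 * real k / 4) * (1/4 - L / 2))"
  proof -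
    have "real N * ln (real d / real m) \<le> real N * (1/4 - L / 2)" using lnd by (intro mult_left_mono) auto
    also have "\<dots> \<le> (3 * real k / 4) * (1/4 - L / 2)" using N L by (intro mult_right_mono_neg) auto
    finally show ?thesis by simp
  qed
  finally have pw: "(real d / real m) ^ N \<le> exp ((3 * real k / 4) * (1/4 - L / 2))" .
  have "exp (real d) * (real d / real m) ^ N \<le> exp (5 * real k / 4) * exp ((3 * real k / 4) * (1/4 - L / 2))"
    using d pw by (intro mult_mono) auto
  also have "\<dots> = exp (5 * real k / 4 + (3 * real k / 4) * (1/4 - L / 2))" by (simp add: exp_add)
  also have "\<dots> \<le> exp (- real k / 4 * L)"
  proof -
    \<comment> \<open>\<open>23/16 = 5/4 + 3/16\<close> collects the constants in the exponent, and
      \<open>L / 8 \<ge> 12/8\<close> exceeds it.\<close>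
    have "real k * (23/16) \<le> real k * (L / 8)" using L by (intro mult_left_mono) auto
    then show ?thesis by (simp add: algebra_simps)
  qed
  also have "\<dots> = real s powr (- real k / 4)" using s0 by (simp add: powr_def L_def)
  finally have main: "exp (real d) * (real d / real m) ^ N \<le> real s powr (- real k / 4)" .
  have "real (m choose d) * real d ^ (2 * k) = (real (m choose d) * real d ^ d) * real d ^ N"
    using d by (simp add: N_def flip: power_add)
  also have "\<dots> \<le> (real m ^ d * exp (real d)) * real d ^ N"
    by (intro mult_right_mono binomial_le_exp_power) auto
  also have "\<dots> = (exp (real d) * (real d / real m) ^ N) * (real m ^ d * real m ^ N)"
    using m0 by (simp add: power_divide)
  also have "real m ^ d * real m ^ N = real m ^ (2 * k)" using d by (simp add: N_def flip: power_add)
  also have "(exp (real d) * (real d / real m) ^ N) * real m ^ (2 * k) \<le> real s powr (- real k / 4) * real m ^ (2 * k)"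
    using main by (intro mult_right_mono) auto
  finally show ?thesis by (simp add: d_def)
qed

text \<open>Rich vectors are extensional functions, \<open>undefined\<close> off \<open>S\<close>,
  whereas reduced vectors are zero off their support; this map translates between the two.\<close>

definition zero_extend :: "nat set \<Rightarrow> (nat \<Rightarrow> int \<times> int) \<Rightarrow> nat \<Rightarrow> int \<times> int" where
  "zero_extend D f = (\<lambda>i. if i \<in> D then f i else (0, 0))"

lemma zero_extend_restrict:
  assumes "\<And>i. i \<notin> D \<Longrightarrow> a i = (0, 0)"
  shows "a = zero_extend D (restrict a D)"
  using assms by (auto simp: zero_extend_def)

text \<open>Enlarge the support to exactly \<open>s\<close> indices, which \<open>s \<le> n\<close>
  permits, choose them in \<open>n choose s\<close> ways and fill them arbitrarily. The 5 leaves
  room for the \<open>exp 1\<close> of the binomial estimate.\<close>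

lemma card_sparse_le:
  fixes n s p :: nat
  assumes s: "1 \<le> s" "s \<le> n"
  defines "X \<equiv> {a. (\<forall>i. a i \<in> grid p) \<and> {i. a i \<noteq> (0, 0)} \<subseteq> {..<n} \<and> card {i. a i \<noteq> (0, 0)} \<le> s}"
  shows "finite X" and "real (card X) \<le> (5 * real n * (real p)\<^sup>2 / real s) ^ s"
proof -
  define DD where "DD = {D. D \<subseteq> {..<n} \<and> card D = s}"
  have finDD: "finite DD" by (simp add: DD_def)
  have finD: "finite D" if "D \<in> DD" for D using that finite_subset by (auto simp: DD_def)
  have sub: "X \<subseteq> (\<Union>D\<in>DD. zero_extend D ` (D \<rightarrow>\<^sub>E grid p))"
  proof
    fix a assume a: "a \<in> X"
    then obtain D where D: "{i. a i \<noteq> (0, 0)} \<subseteq> D" "D \<subseteq> {..<n}" "card D = s"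
      using exists_subset_between[of "{i. a i \<noteq> (0, 0)}" s "{..<n}"] s by (auto simp: X_def)
    then have "a = zero_extend D (restrict a D)" by (intro zero_extend_restrict) auto
    moreover have "restrict a D \<in> D \<rightarrow>\<^sub>E grid p" using a by (auto simp: X_def)
    ultimately show "a \<in> (\<Union>D\<in>DD. zero_extend D ` (D \<rightarrow>\<^sub>E grid p))" using D by (auto simp: DD_def)
  qed
  have finE: "finite (D \<rightarrow>\<^sub>E grid p)" if "D \<in> DD" for D using finD[OF that] by (intro finite_PiE) auto
  have finU: "finite (\<Union>D\<in>DD. zero_extend D ` (D \<rightarrow>\<^sub>E grid p))" using finDD finE by auto
  then show "finite X" using sub finite_subset by blast
  have "card X \<le> card (\<Union>D\<in>DD. zero_extend D ` (D \<rightarrow>\<^sub>E grid p))" using sub finU by (intro card_mono)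
  also have "\<dots> \<le> (\<Sum>D\<in>DD. card (zero_extend D ` (D \<rightarrow>\<^sub>E grid p)))" using finDD by (rule card_UN_le)
  also have "\<dots> \<le> (\<Sum>D\<in>DD. (p\<^sup>2) ^ s)"
  proof (rule sum_mono)
    fix D assume D: "D \<in> DD"
    have "card (zero_extend D ` (D \<rightarrow>\<^sub>E grid p)) \<le> card (D \<rightarrow>\<^sub>E grid p)" by (rule card_image_le[OF finE[OF D]])
    also have "\<dots> = (p\<^sup>2) ^ s" using D finD[OF D] by (simp add: card_PiE card_grid DD_def)
    finally show "card (zero_extend D ` (D \<rightarrow>\<^sub>E grid p)) \<le> (p\<^sup>2) ^ s" .
  qed
  also have "\<dots> = (n choose s) * (p\<^sup>2) ^ s" using n_subsets[of "{..<n}" s] by (simp add: DD_def)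
  finally have "real (card X) \<le> real ((n choose s) * (p\<^sup>2) ^ s)" by (simp only: of_nat_le_iff)
  also have "\<dots> = real (n choose s) * ((real p)\<^sup>2) ^ s" by simp
  also have "real (n choose s) \<le> (5 * real n / real s) ^ s"
  proof -
    have "real (n choose s) * real s ^ s \<le> real n ^ s * exp (real s)" by (rule binomial_le_exp_power)
    also have "exp (real s) = exp 1 ^ s" by (simp flip: exp_of_nat_mult)
    also have "real n ^ s * exp 1 ^ s \<le> real n ^ s * 5 ^ s"
      using exp_le by (intro mult_left_mono power_mono) auto
    finally show ?thesis using s by (simp add: power_divide power_mult_distrib field_simps)
  qed
  then have "real (n choose s) * ((real p)\<^sup>2) ^ s \<le> (5 * real n / real s) ^ s * ((real p)\<^sup>2) ^ s"
    by (intro mult_right_mono) auto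
  also have "\<dots> = (5 * real n * (real p)\<^sup>2 / real s) ^ s" by (simp flip: power_mult_distrib)
  finally show "real (card X) \<le> (5 * real n * (real p)\<^sup>2 / real s) ^ s" by simp
qed

text \<open>Makes the exponent independent of \<open>S\<close>. For \<open>\<beta> \<le> 1\<close>
  the base is at least 1, so the exponent may grow to \<open>n\<close>; for
  \<open>\<beta> > 1\<close> nothing is rich, since relations cannot outnumber tuples.\<close>

lemma card_rich_vectors_uniform:
  assumes k: "k \<ge> 1" and \<beta>: "\<beta> > 0" and s: "s \<ge> 1" and S: "finite S" "s \<le> card S" "card S \<le> n"
  shows "real (card (rich_vectors p k s \<beta> S)) \<le> real p ^ (2 * s) * (4 / \<beta>) ^ n"
proof (cases "\<beta> \<le> 1")
  case True
  then have "1 \<le> 4 / \<beta>" using \<beta> by (simp add: field_simps)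
  then have "(4 / \<beta>) ^ (card S - s) \<le> (4 / \<beta>) ^ n" using S by (intro power_increasing) auto
  then have "real p ^ (2 * s) * (4 / \<beta>) ^ (card S - s) \<le> real p ^ (2 * s) * (4 / \<beta>) ^ n"
    by (intro mult_left_mono) auto
  then show ?thesis using card_rich_vectors[OF k \<beta> S(1,2), of p] by linarith
next
  case False
  have "rich_vectors p k s \<beta> S = {}"
  proof (rule ccontr)
    assume "rich_vectors p k s \<beta> S \<noteq> {}"
    then obtain a where "a \<in> rich_vectors p k s \<beta> S" by blast
    then have "\<beta> * card S ^ (2 * k) \<le> card (generic_relations p k a S)"
      using S by (auto simp: rich_vectors_def)
    also have "card (generic_relations p k a S) \<le> card ({..<2*k} \<rightarrow>\<^sub>E S)"
      using S by (intro card_mono finite_PiE) (auto simp: generic_relations_def relations_def)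
    also have "\<dots> = card S ^ (2 * k)" by (simp add: card_PiE)
    finally have "\<beta> * real (card S) ^ (2 * k) \<le> 1 * real (card S) ^ (2 * k)" by simp
    moreover have "real (card S) ^ (2 * k) > 0" using S s by simp
    ultimately show False using False by (simp only: mult_le_cancel_right_pos)
  qed
  then show ?thesis using \<beta> by simp
qed

lemma card_dense_le:
  assumes k: "k \<ge> 1" and \<beta>: "\<beta> > 0" and s: "s \<ge> 1"
    and Y: "\<And>a. a \<in> Y \<Longrightarrow> \<exists>S\<subseteq>{..<n}. s \<le> card S \<and> a \<in> zero_extend S ` rich_vectors p k s \<beta> S"
  shows "finite Y" and "real (card Y) \<le> 2 ^ n * (real p ^ (2 * s) * (4 / \<beta>) ^ n)"
proof -
  define SS where "SS = {S. S \<subseteq> {..<n} \<and> s \<le> card S}"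
  have finSS: "finite SS" by (rule finite_subset[of _ "Pow {..<n}"]) (auto simp: SS_def)
  have finS: "finite S" "card S \<le> n" if "S \<in> SS" for S
    using that finite_subset card_mono[of "{..<n}" S] by (auto simp: SS_def)
  have sub: "Y \<subseteq> (\<Union>S\<in>SS. zero_extend S ` rich_vectors p k s \<beta> S)" using Y by (fastforce simp: SS_def)
  have finU: "finite (\<Union>S\<in>SS. zero_extend S ` rich_vectors p k s \<beta> S)" using finSS finS by auto
  show "finite Y" using sub finU finite_subset by blast
  have "card Y \<le> card (\<Union>S\<in>SS. zero_extend S ` rich_vectors p k s \<beta> S)" using sub finU by (intro card_mono)
  also have "\<dots> \<le> (\<Sum>S\<in>SS. card (zero_extend S ` rich_vectors p k s \<beta> S))" using finSS by (rule card_UN_le)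
  also have "\<dots> \<le> (\<Sum>S\<in>SS. card (rich_vectors p k s \<beta> S))"
    using finS by (intro sum_mono card_image_le) auto
  finally have "real (card Y) \<le> (\<Sum>S\<in>SS. real (card (rich_vectors p k s \<beta> S)))"
    by (simp only: of_nat_le_iff flip: of_nat_sum)
  also have "\<dots> \<le> (\<Sum>S\<in>SS. real p ^ (2 * s) * (4 / \<beta>) ^ n)"
    using finS by (intro sum_mono card_rich_vectors_uniform k \<beta> s) (auto simp: SS_def)
  also have "\<dots> = card SS * (real p ^ (2 * s) * (4 / \<beta>) ^ n)" by simp
  also have "\<dots> \<le> 2 ^ n * (real p ^ (2 * s) * (4 / \<beta>) ^ n)"
  proof (rule mult_right_mono)
    have "card SS \<le> card (Pow {..<n})" by (rule card_mono) (auto simp: SS_def)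
    then have "card SS \<le> 2 ^ n" by (simp add: card_Pow)
    from of_nat_mono[OF this, where 'a = real] show "real (card SS) \<le> 2 ^ n" by simp
  qed (use \<beta> in auto)
  finally show "real (card Y) \<le> 2 ^ n * (real p ^ (2 * s) * (4 / \<beta>) ^ n)" .
qed

section \<open>Constants depending only on C, and the assembly\<close>

text \<open>The slope of the chord of \<open>exp (- t / (2 C))\<close> over \<open>[0, 2]\<close>, up to sign.\<close>

definition lazy_rate :: "real \<Rightarrow> real" where
  "lazy_rate C = (1 - exp (- 1 / C)) / 2"

text \<open>\<open>exp (1/2)\<close> comes from the Gaussian majorant of the disc, \<open>C\<close>
  from Jensen's inequality on the annulus, and the square from the Gaussian sum over the
  lattice.\<close>

definition small_ball_const :: "real \<Rightarrow> real" where
  "small_ball_const C = exp (1/2) * C * (2 / (1 - exp (- (1 / (2 * C\<^sup>2)))))\<^sup>2"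

definition level_const :: "real \<Rightarrow> real" where
  "level_const C = 1 / (1 - exp (- lazy_rate C))\<^sup>2"

definition moment_const :: "real \<Rightarrow> real" where
  "moment_const C = 16 * level_const C + 4 / lazy_rate C"

text \<open>The lower bound is what makes \<open>1000 * C \<le> k\<close> effective: it converts
  \<open>k * k \<le> s\<close> into \<open>8 * k \<le> \<mu> * card S\<close> and makes the
  high-energy term at most \<open>exp (- s / k)\<close>.\<close>

lemma lazy_rate_bounds:
  assumes "C \<ge> 1"
  shows "1 / (4 * C) \<le> lazy_rate C" "0 < lazy_rate C" "lazy_rate C \<le> 1/2"
proof -
  have "exp (- 1 / C) = 1 / exp (1 / C)" by (simp add: exp_minus field_simps)
  also have "\<dots> \<le> 1 / (1 + 1 / C)" using assms exp_ge_add_one_self[of "1 / C"] by (intro frac_le) (auto simp: add_pos_pos)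
  also have "\<dots> = 1 - 1 / (C + 1)" using assms by (simp add: field_simps)
  also have "\<dots> \<le> 1 - 1 / (2 * C)" using assms by (simp add: frac_le)
  finally show 1: "1 / (4 * C) \<le> lazy_rate C" by (simp add: lazy_rate_def)
  have "0 < 1 / (4 * C)" using assms by simp
  then show "0 < lazy_rate C" using 1 by linarith
  show "lazy_rate C \<le> 1/2" by (simp add: lazy_rate_def)
qed

lemma const_pos:
  assumes "C \<ge> 1"
  shows "small_ball_const C > 0" "level_const C > 0" "moment_const C > 0"
proof -
  show "small_ball_const C > 0" using assms by (simp add: small_ball_const_def)
  show "level_const C > 0" using lazy_rate_bounds[OF assms] by (simp add: level_const_def)
  then show "moment_const C > 0" using lazy_rate_bounds[OF assms] by (simp add: moment_const_def add_pos_pos)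
qed

lemma phi_eq_red: "phi p v i = red p (v i)"
  by (simp add: phi_def red_def)

lemma pdvd_phi_iff: "p > 0 \<Longrightarrow> pdvd p (phi p v i) \<longleftrightarrow> phi p v i = (0, 0)"
  by (auto simp: pdvd_def phi_def dvd_eq_mod_eq_0)

lemma energy_phi: "p > 0 \<Longrightarrow> energy p (phi p v) S w = energy p v S w"
  by (simp add: energy_def phi_eq_red chr_red_left)

text \<open>The Fourier bound for \<open>\<rho>\<close> has three terms. \<open>r1\<close> and
  \<open>r2\<close> limit the first and the last to \<open>\<rho> / 4\<close> each, so the moment
  accounts for \<open>\<rho> / 2\<close>. By \<open>r3\<close>, tuples with few distinct values
  supply at most half of the resulting relations.\<close>

lemma generic_relations_phi_ge:
  assumes M: "is_cplx_rv M" "good C M" and v: "v \<in> Vrho M n \<rho>" and p: "prime p"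
    and S: "S \<subseteq> {..<n}" "\<And>j. j \<in> S \<Longrightarrow> phi p v j \<noteq> (0, 0)" "s \<le> card S"
    and k: "1000 * C \<le> real k" and s: "k\<^sup>2 \<le> s" and \<rho>: "\<rho> > 0"
  assumes r1: "4 * small_ball_const C * level_const C \<le> \<rho> * p"
    and r2: "4 * small_ball_const C * exp (- real s / real k) \<le> \<rho>"
    and r3: "4 * small_ball_const C * moment_const C * real s powr (- real k / 4) \<le> \<rho>"
  shows "\<rho> * sqrt (s / k) / (4 * small_ball_const C * moment_const C) * card S ^ (2 * k)
    \<le> card (generic_relations p k (phi p v) S)"
proof -
  have C: "C \<ge> 1" using M by (simp add: good_def)
  note pos = const_pos[OF C]
  note rate = lazy_rate_bounds[OF C]
  define K where "K = small_ball_const C"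
  define c0 where "c0 = level_const C"
  define c1 where "c1 = moment_const C"
  define \<mu> where "\<mu> = lazy_rate C"
  define m where "m = real (card S)"
  define a where "a = phi p v"
  define R where "R = real (card (relations p k a S)) / m ^ (2 * k)"
  define D where "D = real ((card S choose (5 * k div 4)) * (5 * k div 4) ^ (2 * k)) / m ^ (2 * k)"
  define G where "G = real (card (generic_relations p k a S)) / m ^ (2 * k)"
  define q where "q = sqrt (m / k)"
  have K0: "K > 0" "c0 > 0" "c1 > 0" using pos by (auto simp: K_def c0_def c1_def)
  have p0: "p > 0" using p prime_gt_0_nat by blast
  have finS: "finite S" using S finite_subset by blast
  have k1000: "real k \<ge> 1000" using k C by linarith
  then have k1000n: "k \<ge> 1000" by simp
  have sk: "real k * real k \<le> real s" using s by (metis of_nat_le_iff of_nat_mult power2_eq_square)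
  have sm: "real s \<le> m" using S by (simp add: m_def)
  have ks: "real k \<le> real s" using sk k1000 mult_right_mono[of 1 "real k" "real k"] by linarith
  have m0: "m > 0" using sm ks k1000 by linarith
  have km: "1000 * C * real k \<le> m"
  proof -
    have "1000 * C * real k \<le> real k * real k" using k by (intro mult_right_mono) auto
    then show ?thesis using sk sm by linarith
  qed
  have \<mu>m: "m / (4 * C) \<le> \<mu> * m"
    using mult_right_mono[OF rate(1), of m] m0 by (simp add: \<mu>_def)
  have large: "8 * real k \<le> \<mu> * card S"
  proof -
    have "0 \<le> C * real k" using C by simp
    then have "32 * (C * real k) \<le> m" using km by linarith
    then have "8 * real k \<le> m / (4 * C)" using C by (simp add: field_simps)
    then show ?thesis using \<mu>m by (simp add: m_def)
  qed
  have "\<rho> \<le> rho_conc 1 M n v" using v by (simp add: Vrho_def)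
  also have "\<dots> \<le> K * ((\<Sum>w\<in>grid p. exp (- \<mu> * energy p v S w)) / p\<^sup>2)"
    unfolding K_def small_ball_const_def \<mu>_def lazy_rate_def by (rule rho_conc_le[OF M p0 S(1)])
  also have "(\<Sum>w\<in>grid p. exp (- \<mu> * energy p v S w)) = (\<Sum>w\<in>grid p. exp (- \<mu> * energy p a S w))"
    by (simp add: a_def energy_phi[OF p0])
  also have "K * ((\<Sum>w\<in>grid p. exp (- \<mu> * energy p a S w)) / p\<^sup>2)
      \<le> K * ((p * c0 + c1 * moment p k a S / q + p\<^sup>2 * exp (- \<mu> * m / 2)) / p\<^sup>2)"
  proof (intro mult_left_mono divide_right_mono)
    have "(\<Sum>w\<in>grid p. exp (- \<mu> * energy p a S w)) \<le>
       p / (1 - exp (- \<mu>))\<^sup>2 + (16 / (1 - exp (- \<mu>))\<^sup>2 + 4 / \<mu>) * moment p k a S / sqrt (card S / k)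
       + (real p)\<^sup>2 * exp (- \<mu> * card S / 2)"
      using rate k1000n large S(2)
      by (intro sum_exp_energy_le[OF p finS]) (auto simp: \<mu>_def a_def pdvd_phi_iff[OF p0])
    then show "(\<Sum>w\<in>grid p. exp (- \<mu> * energy p a S w)) \<le> p * c0 + c1 * moment p k a S / q + p\<^sup>2 * exp (- \<mu> * m / 2)"
      by (simp add: c0_def c1_def level_const_def moment_const_def q_def m_def \<mu>_def)
  qed (use K0 in auto)
  also have "(p * c0 + c1 * moment p k a S / q + p\<^sup>2 * exp (- \<mu> * m / 2)) / p\<^sup>2
      = c0 / p + c1 * (moment p k a S / p\<^sup>2) / q + exp (- \<mu> * m / 2)"
    using p0 by (simp add: add_divide_distrib power2_eq_square)
  also have "moment p k a S / p\<^sup>2 = R"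
    using p0 by (simp add: moment_eq_card_relations[OF p0 finS] R_def m_def)
  finally have main: "\<rho> \<le> K * (c0 / p) + K * c1 * R / q + K * exp (- \<mu> * m / 2)"
    by (simp add: algebra_simps)
  have e1: "K * (c0 / p) \<le> \<rho> / 4"
    using r1 p0 by (simp add: K_def c0_def field_simps)
  have e2: "K * exp (- \<mu> * m / 2) \<le> \<rho> / 4"
  proof -
    \<comment> \<open>\<open>k \<ge> 8 * C\<close> here, so half of the rate bound
      \<open>m / (4 * C)\<close> already exceeds \<open>s / k\<close>.\<close>
    have "real s / real k \<le> real s / (8 * C)" using k C ks by (intro divide_left_mono) auto
    also have "\<dots> \<le> m / (8 * C)" using sm C by (intro divide_right_mono) auto
    also have "\<dots> \<le> \<mu> * m / 2" using \<mu>m by simp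
    finally have "exp (- \<mu> * m / 2) \<le> exp (- real s / real k)" by simp
    then have "K * exp (- \<mu> * m / 2) \<le> K * exp (- real s / real k)" using K0 by (intro mult_left_mono) auto
    then show ?thesis using r2 by (simp add: K_def)
  qed
  have q0: "q \<ge> 1" "q \<ge> sqrt (s / k)"
  proof -
    have "1 \<le> m / k" using ks sm k1000 by simp
    then show "q \<ge> 1" by (simp add: q_def)
    show "q \<ge> sqrt (s / k)" using sm by (simp add: q_def divide_right_mono)
  qed
  have "\<rho> / 2 \<le> K * c1 * R / q" using main e1 e2 by linarith
  then have R: "\<rho> * q / (2 * K * c1) \<le> R" using q0 K0 by (simp add: field_simps)
  have "R \<le> G + D"
  proof -
    have "5 * k div 4 \<le> card S"
    proof -
      have "2 * real k \<le> 1000 * C * real k" using C by (intro mult_right_mono) auto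
      then have "2 * real k \<le> real (card S)" using km by (simp add: m_def)
      then show ?thesis by linarith
    qed
    then have "real (card (relations p k a S)) \<le>
      real (card (generic_relations p k a S) + (card S choose (5 * k div 4)) * (5 * k div 4) ^ (2 * k))"
      using card_relations_le[OF finS] of_nat_le_iff by blast
    then show ?thesis unfolding R_def G_def D_def add_divide_distrib[symmetric] of_nat_add
      using m0 by (intro divide_right_mono) auto
  qed
  moreover have "D \<le> \<rho> * q / (4 * K * c1)"
  proof -
    have "real (card S choose (5 * k div 4)) * real (5 * k div 4) ^ (2 * k) \<le> real s powr (- real k / 4) * m ^ (2 * k)"
      unfolding m_def by (rule few_values_negligible[OF k1000n s S(3)])
    then have "D \<le> real s powr (- real k / 4)" using m0 by (simp add: D_def divide_le_eq)
    also have "\<dots> \<le> \<rho> / (4 * K * c1)" using r3 K0 by (simp add: K_def c1_def field_simps)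
    also have "\<dots> \<le> \<rho> * q / (4 * K * c1)" using q0 \<rho> K0 by (intro divide_right_mono) auto
    finally show ?thesis .
  qed
  moreover have "\<rho> * q / (2 * K * c1) = \<rho> * q / (4 * K * c1) + \<rho> * q / (4 * K * c1)" by simp
  ultimately have "\<rho> * q / (4 * K * c1) \<le> G" using R by linarith
  moreover have "\<rho> * sqrt (s / k) / (4 * K * c1) \<le> \<rho> * q / (4 * K * c1)"
    using q0 \<rho> K0 by (intro divide_right_mono mult_left_mono) auto
  ultimately have "\<rho> * sqrt (s / k) / (4 * K * c1) \<le> G" by linarith
  then have "\<rho> * sqrt (s / k) / (4 * K * c1) * m ^ (2 * k) \<le> card (generic_relations p k a S)"
    using m0 by (simp add: G_def le_divide_eq)
  then show ?thesis by (simp add: K_def c1_def a_def m_def)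
qed

theorem theorem1p2:
  fixes C\<^sub>\<xi> :: real
  assumes "C\<^sub>\<xi> \<ge> 1"
  shows "\<exists>C'::real. C' \<ge> 1 \<and>
    (\<forall>M n s k (\<rho>::real) (p::nat).
       is_cplx_rv M \<longrightarrow> good C\<^sub>\<xi> M \<longrightarrow>
       0 < \<rho> \<longrightarrow> \<rho> < 1 \<longrightarrow>
       1000 * C\<^sub>\<xi> \<le> real k \<longrightarrow> real k \<le> sqrt (real s) \<longrightarrow>
       sqrt (real s) \<le> real s \<longrightarrow> real s \<le> real n / ln (real n) \<longrightarrow>
       \<rho> \<ge> C' * max (exp (- real s / real k)) (real s powr (- real k / 4)) \<longrightarrow>
       prime p \<longrightarrow> odd p \<longrightarrow>
       2 powr (real n / real s) \<ge> real p \<longrightarrow> real p \<ge> C' / \<rho> \<longrightarrow>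
       real (card (phi p ` Vrho M n \<rho>)) \<le>
         (5 * real n * (real p)\<^sup>2 / real s) ^ s
         + (C' / \<rho> / sqrt (real s / real k)) ^ n)"
proof -
  define K where "K = small_ball_const C\<^sub>\<xi>"
  define c0 where "c0 = level_const C\<^sub>\<xi>"
  define c1 where "c1 = moment_const C\<^sub>\<xi>"
  have K0: "K > 0" "c0 > 0" "c1 > 0" using const_pos[OF assms] by (auto simp: K_def c0_def c1_def)
  \<comment> \<open>\<open>128 = 2 * 4 * 4 * 4\<close>: choice of the support,
    \<open>p ^ (2 * s) \<le> 4 ^ n\<close>, the loss \<open>4 / \<beta>\<close> per removed
    coordinate, and the 4 in the denominator of \<open>\<beta>\<close>. The other summands serve
    \<open>r1\<close>, \<open>r2\<close> and \<open>C' \<ge> 1\<close>.\<close>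
  define C' where "C' = 128 * K * c1 + 4 * K * c0 + 4 * K + 1"
  have "K * c0 > 0" "K * c1 > 0" using K0 by auto
  then have C': "C' \<ge> 1" "4 * K \<le> C'" "4 * K * c0 \<le> C'" "4 * K * c1 \<le> C'" "128 * K * c1 \<le> C'"
    using K0 by (auto simp: C'_def)
  show ?thesis
  proof (intro exI[of _ C'] conjI allI impI)
    show "C' \<ge> 1" by fact
    fix M n s k \<rho> p
    assume M: "is_cplx_rv M" "good C\<^sub>\<xi> M" and \<rho>: "0 < \<rho>" "\<rho> < 1"
      and k: "1000 * C\<^sub>\<xi> \<le> real k" "real k \<le> sqrt (real s)" and n: "real s \<le> real n / ln (real n)"
      and \<rho>_ge: "\<rho> \<ge> C' * max (exp (- real s / real k)) (real s powr (- real k / 4))"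
      and p: "prime p" and p_le: "2 powr (real n / real s) \<ge> real p" and p_ge: "real p \<ge> C' / \<rho>"
    have p0: "p > 0" using p prime_gt_0_nat by blast
    have k1000: "real k \<ge> 1000" using k assms by linarith
    have "(real k)\<^sup>2 \<le> (sqrt (real s))\<^sup>2" using k(2) by (intro power_mono) auto
    then have "real (k\<^sup>2) \<le> real s" by simp
    then have s: "k\<^sup>2 \<le> s" by (simp only: of_nat_le_iff)
    have ks: "real k \<le> real s"
    proof -
      have "real k * 1 \<le> real k * real k" using k1000 by (intro mult_left_mono) auto
      then show ?thesis using \<open>real (k\<^sup>2) \<le> real s\<close> by (simp add: power2_eq_square)
    qed
    have s1: "s \<ge> 1" using ks k1000 by linarith
    have sn: "s \<le> n"
    proof -
      \<comment> \<open>For \<open>n = 0\<close> and \<open>n = 1\<close> the quotient is 0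
        (division by zero gives 0 when \<open>n = 1\<close>), and for \<open>n = 2\<close> it is at
        most 4; all contradict \<open>s \<ge> 1000\<close>. From 3 on,
        \<open>ln n \<ge> 1\<close>.\<close>
      have "n \<ge> 3"
      proof (rule ccontr)
        assume "\<not> n \<ge> 3"
        then have "n = 0 \<or> n = 1 \<or> n = 2" by linarith
        moreover have "2 / ln (2::real) \<le> 4" using ln2_ge_two_thirds by (simp add: field_simps)
        ultimately have "real n / ln (real n) \<le> 4" by auto
        then show False using n ks k1000 by linarith
      qed
      then have "exp 1 \<le> real n" using exp_le by linarith
      then have "1 \<le> ln (real n)" using \<open>n \<ge> 3\<close> by (simp add: ln_ge_iff)
      then have "real n / ln (real n) \<le> real n / 1" by (intro divide_left_mono) auto
      then show ?thesis using n by linarith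
    qed
    define \<beta> where "\<beta> = \<rho> * sqrt (s / k) / (4 * K * c1)"
    have sq: "sqrt (real s / real k) > 0" using ks k1000 by simp
    have \<beta>: "\<beta> > 0" using \<rho> sq K0 by (simp add: \<beta>_def)
    have r1: "4 * K * c0 \<le> \<rho> * p"
    proof -
      have "C' \<le> \<rho> * p" using p_ge \<rho> by (simp add: field_simps)
      then show ?thesis using C' by linarith
    qed
    have r2: "4 * K * exp (- real s / real k) \<le> \<rho>"
    proof -
      have "4 * K * exp (- real s / real k) \<le> C' * max (exp (- real s / real k)) (real s powr (- real k / 4))"
        using C' by (intro mult_mono) auto
      then show ?thesis using \<rho>_ge by linarith
    qed
    have r3: "4 * K * c1 * real s powr (- real k / 4) \<le> \<rho>"
    proof -
      have "4 * K * c1 * real s powr (- real k / 4) \<le> C' * max (exp (- real s / real k)) (real s powr (- real k / 4))"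
        using C' by (intro mult_mono) auto
      then show ?thesis using \<rho>_ge by linarith
    qed
    define X where "X = {a. (\<forall>i. a i \<in> grid p) \<and> {i. a i \<noteq> (0, 0)} \<subseteq> {..<n} \<and> card {i. a i \<noteq> (0, 0)} \<le> s}"
    define Y where "Y = phi p ` Vrho M n \<rho> - X"
    have X: "finite X" "real (card X) \<le> (5 * real n * (real p)\<^sup>2 / real s) ^ s"
      unfolding X_def using card_sparse_le[OF s1 sn] by auto
    have Y_rich: "\<exists>S\<subseteq>{..<n}. s \<le> card S \<and> a \<in> zero_extend S ` rich_vectors p k s \<beta> S" if a: "a \<in> Y" for a
    proof -
      obtain v where v: "v \<in> Vrho M n \<rho>" "a = phi p v" using a by (auto simp: Y_def)
      \<comment> \<open>The support is that of the reduced vector, so no entry indexed by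
        \<open>S\<close> vanishes modulo \<open>p\<close>, as the energy estimates require.\<close>
      define S where "S = {i. a i \<noteq> (0, 0)}"
      have grid: "a i \<in> grid p" for i using red_in_grid[OF p0] by (simp add: v phi_eq_red)
      have Sn: "S \<subseteq> {..<n}"
        using v(1) by (force simp: S_def v(2) Vrho_def gvecs_def phi_def not_less[symmetric])
      have "\<not> card S \<le> s" using a grid Sn by (auto simp: Y_def X_def S_def)
      then have sS: "s \<le> card S" by simp
      have eq: "a = zero_extend S (restrict a S)" by (rule zero_extend_restrict) (simp add: S_def)
      have "restrict a S \<in> rich_vectors p k s \<beta> S"
        unfolding rich_vectors_def
      proof (intro CollectI conjI allI impI)
        show "restrict a S \<in> S \<rightarrow>\<^sub>E grid p" using grid by auto
        fix S' assume S': "S' \<subseteq> S" "s \<le> card S'"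
        have "generic_relations p k (restrict a S) S' = generic_relations p k (phi p v) S'"
          using S' v by (intro generic_relations_cong) auto
        moreover have "\<beta> * card S' ^ (2 * k) \<le> card (generic_relations p k (phi p v) S')"
          unfolding \<beta>_def K_def c1_def
          using S' Sn v r1 r2 r3
          by (intro generic_relations_phi_ge[OF M v(1) p _ _ S'(2) k(1) s \<rho>(1)])
            (auto simp: S_def K_def c0_def c1_def)
        ultimately show "\<beta> * card S' ^ (2 * k) \<le> card (generic_relations p k (restrict a S) S')" by simp
      qed
      then show ?thesis using Sn sS eq by blast
    qed
    have k1: "k \<ge> 1" using k1000 by simp
    note Y = card_dense_le[where Y = Y, OF k1 \<beta> s1 Y_rich]
    have "real (card Y) \<le> 2 ^ n * (real p ^ (2 * s) * (4 / \<beta>) ^ n)" by (rule Y(2))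
    also have "real p ^ (2 * s) \<le> 4 ^ n"
    proof -
      have "real p ^ (2 * s) \<le> (2 powr (real n / real s)) ^ (2 * s)" using p_le by (intro power_mono) auto
      also have "\<dots> = 2 powr (real n / real s * real (2 * s))"
        by (subst powr_realpow[symmetric]) (auto simp: powr_powr)
      also have "real n / real s * real (2 * s) = real (2 * n)" using s1 by simp
      also have "2 powr real (2 * n) = (2::real) ^ (2 * n)" by (rule powr_realpow) simp
      also have "\<dots> = 4 ^ n" by (simp add: power_mult)
      finally show ?thesis .
    qed
    then have "2 ^ n * (real p ^ (2 * s) * (4 / \<beta>) ^ n) \<le> 2 ^ n * (4 ^ n * (4 / \<beta>) ^ n)"
      using \<beta> by (intro mult_left_mono mult_right_mono) auto
    also have "2 ^ n * (4 ^ n * (4 / \<beta>) ^ n) = (2 * (4 * (4 / \<beta>))) ^ n"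
      by (simp only: power_mult_distrib)
    also have "2 * (4 * (4 / \<beta>)) = 128 * K * c1 / \<rho> / sqrt (real s / real k)"
      using \<rho> sq K0 by (simp add: \<beta>_def field_simps)
    also have "(128 * K * c1 / \<rho> / sqrt (real s / real k)) ^ n \<le> (C' / \<rho> / sqrt (real s / real k)) ^ n"
      using C' \<rho> K0 by (intro power_mono divide_right_mono) auto
    finally have Yc: "real (card Y) \<le> (C' / \<rho> / sqrt (real s / real k)) ^ n" by simp
    have "card (phi p ` Vrho M n \<rho>) \<le> card (X \<union> Y)"
      using X(1) Y(1) by (intro card_mono) (auto simp: Y_def)
    also have "\<dots> \<le> card X + card Y" by (rule card_Un_le)
    finally have "real (card (phi p ` Vrho M n \<rho>)) \<le> real (card X) + real (card Y)" by linarith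
    then show "real (card (phi p ` Vrho M n \<rho>)) \<le>
         (5 * real n * (real p)\<^sup>2 / real s) ^ s + (C' / \<rho> / sqrt (real s / real k)) ^ n"
      using X(2) Yc by linarith
  qed
qed

end
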